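(* Let $p\ge1$. Let $\mathcal{S}_{6+4p}:=\mathcal{M}_{6+4p,0}$ be the manifold $\mathcal{M}_{6+4p,f}$ (defined in the context) with $f=0$. Then: \begin{enumerate} \item $\mathcal{S}_{6+4p}$ is an indecomposable symmetric space. \item $\mathcal{M}_{6+4p,f}$ is $0$-modeled on $\mathcal{S}_{6+4p}$ for any smooth function $f=f(z_0,\dots,z_p)$ on $\mathbb{R}^{p+1}$. \end{enumerate}
   Context: Let $(x,z_0,\dots,z_p,\tilde z_0,\dots,\tilde z_p,x^*,z_0^*,\dots,z_p^*,\tilde z_0^*,\dots,\tilde z_p^* )$ be coordinates on $\mathbb{R}^{6+4p}$. For a smooth function $f=f(z_0,\dots,z_p)$ on $\mathbb{R}^{p+1}$, $\mathcal{M}_{6+4p,f}:=(\mathbb{R}^{6+4p},g_{6+4p,f})$, where $g_{6+4p,f}$ is the metric of neutral signature $(3+2p,3+2p)$ whose only non-zero components (up to symmetry) are $$g_{6+4p,f}(\partial_x,\partial_x)=-2\{f(z_0,\dots,z_p)+z_0\tilde z_0+\dots+z_p\tilde z_p\},$$ $$g_{6+4p,f}(\partial_x,\partial_{x^*})=g_{6+4p,f}(\partial_{z_i},\partial_{z_i^*})=g_{6+4p,f}(\partial_{\tilde z_i},\partial_{\tilde z_i^*})=1\quad(0\le i\le p).$$ For a pseudo-Riemannian manifold $\mathcal{M}=(M,g)$ with Levi-Civita connection $\nabla$, curvature tensor $R(\xi_1,\xi_2,\xi_3,\xi_4)=g((\nabla_{\xi_1}\nabla_{\xi_2}-\nabla_{\xi_2}\nabla_{\xi_1}-\nabla_{[\xi_1,\xi_2]})\xi_3,\xi_4)$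 and $P\in M$, set $\mathfrak{M}^k(\mathcal{M},P):=(T_PM,g_P,R_P,\dots,\nabla^kR_P)$. An isomorphism between two such objects is a linear isomorphism of the tangent spaces which pulls back the metric and all the tensors $\nabla^iR$, $0\le i\le k$, to one another. $\mathcal{M}$ is $k$-modeled on a homogeneous pseudo-Riemannian manifold $\mathcal{N}$ if $\mathfrak{M}^k(\mathcal{M},P)$ and $\mathfrak{M}^k(\mathcal{N},Q)$ are isomorphic for any $P\in M$ and $Q\in N$. A pseudo-Riemannian manifold $\mathcal{M}=(M,g)$ is said to be indecomposable if there does not exist a non-trivial decomposition of $T_PM$ which is invariant under the holonomy representation.
   Formalization: "Decomposition" of T_PM is taken to be an orthogonal direct sum, as is standard; for arbitrary direct sums indecomposability fails, since span(∂x, ∂z*, ∂z̃* ) and span(∂z, ∂z̃, ∂x* ) are complementary and holonomy invariant. *)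

theory Defs
  imports "HOL-Analysis.Analysis"
begin

section \<open>Pseudo-Riemannian geometry of \<open>\<real>\<^sup>m\<close> in global coordinates\<close>

text \<open>The underlying manifold is always \<^typ>\<open>real ^ 'a\<close>. Its tangent spaces are identified with
  \<^typ>\<open>real ^ 'a\<close> through the coordinate frame \<open>\<partial>\<^sub>i = axis i 1\<close>. A metric is the matrix field of
  its components \<open>g(\<partial>\<^sub>i, \<partial>\<^sub>j)\<close>, and vector fields are maps \<^typ>\<open>real ^ 'a \<Rightarrow> real ^ 'a\<close>.\<close>

type_synonym 'a metric = "real ^ 'a \<Rightarrow> real ^ 'a ^ 'a"
type_synonym 'a vfield = "real ^ 'a \<Rightarrow> real ^ 'a"

definition dird :: "(real ^ 'a::finite \<Rightarrow> 'b::real_normed_vector) \<Rightarrow> real ^ 'a \<Rightarrow> real ^ 'a \<Rightarrow> 'b"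
  where "dird F P v = frechet_derivative F (at P) v"

primrec Ck :: "nat \<Rightarrow> (real ^ 'a::finite \<Rightarrow> real) \<Rightarrow> bool" where
  "Ck 0 F \<longleftrightarrow> continuous_on UNIV F"
| "Ck (Suc k) F \<longleftrightarrow> (\<forall>P. F differentiable (at P)) \<and> (\<forall>i. Ck k (\<lambda>P. dird F P (axis i 1)))"

definition smooth :: "(real ^ 'a::finite \<Rightarrow> real) \<Rightarrow> bool"
  where "smooth F \<longleftrightarrow> (\<forall>k. Ck k F)"

definition smooth_map :: "(real ^ 'a::finite \<Rightarrow> real ^ 'b::finite) \<Rightarrow> bool"
  where "smooth_map \<phi> \<longleftrightarrow> (\<forall>i. smooth (\<lambda>P. \<phi> P $ i))"

definition bform :: "real ^ 'a ^ 'a \<Rightarrow> real ^ 'a::finite \<Rightarrow> real ^ 'a \<Rightarrow> real"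
  where "bform A v w = v \<bullet> (A *v w)"

definition pseudo_riemannian :: "'a::finite metric \<Rightarrow> bool"
  where "pseudo_riemannian g \<longleftrightarrow>
    (\<forall>i j. smooth (\<lambda>P. g P $ i $ j)) \<and> (\<forall>P. transpose (g P) = g P \<and> invertible (g P))"


subsection \<open>Levi-Civita connection and curvature\<close>

text \<open>Christoffel symbols of the first kind, \<open>\<Gamma>\<^sub>i\<^sub>j\<^sub>k = g(\<nabla>\<^bsub>\<partial>\<^sub>i\<^esub> \<partial>\<^sub>j, \<partial>\<^sub>k)\<close>, given by the Koszul formula.\<close>

definition christoffel1 :: "'a::finite metric \<Rightarrow> real ^ 'a \<Rightarrow> 'a \<Rightarrow> 'a \<Rightarrow> 'a \<Rightarrow> real"
  where "christoffel1 g P i j k =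
    (dird (\<lambda>Q. g Q $ j $ k) P (axis i 1) + dird (\<lambda>Q. g Q $ i $ k) P (axis j 1)
      - dird (\<lambda>Q. g Q $ i $ j) P (axis k 1)) / 2"

definition christoffel :: "'a::finite metric \<Rightarrow> real ^ 'a \<Rightarrow> real ^ 'a \<Rightarrow> real ^ 'a \<Rightarrow> real ^ 'a"
  where "christoffel g P v w =
    matrix_inv (g P) *v (\<chi> k. \<Sum>i\<in>UNIV. \<Sum>j\<in>UNIV. christoffel1 g P i j k * v $ i * w $ j)"

definition nabla :: "'a::finite metric \<Rightarrow> 'a vfield \<Rightarrow> 'a vfield \<Rightarrow> 'a vfield"
  where "nabla g \<xi> \<eta> = (\<lambda>P. dird \<eta> P (\<xi> P) + christoffel g P (\<xi> P) (\<eta> P))"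

definition bracket :: "'a::finite vfield \<Rightarrow> 'a vfield \<Rightarrow> 'a vfield"
  where "bracket \<xi> \<eta> = (\<lambda>P. dird \<eta> P (\<xi> P) - dird \<xi> P (\<eta> P))"

lemma metric_sym:
  assumes "pseudo_riemannian g"
  shows "g Q $ i $ j = g Q $ j $ i"
proof -
  have "g Q $ i $ j = transpose (g Q) $ j $ i" by (simp add: transpose_def)
  with assms show ?thesis by (simp add: pseudo_riemannian_def)
qed

text \<open>\<^const>\<open>nabla\<close> is torsion-free and metric, i.e. it is the Levi-Civita connection.\<close>

lemma nabla_torsion_free:
  assumes "pseudo_riemannian g"
  shows "nabla g \<xi> \<eta> P - nabla g \<eta> \<xi> P = bracket \<xi> \<eta> P"
proof -
  have sym: "g Q $ i $ j = g Q $ j $ i" for Q i j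
    using assms by (rule metric_sym)
  have eq: "(\<lambda>Q. g Q $ i $ j) = (\<lambda>Q. g Q $ j $ i)" for i j
    by (rule ext) (rule sym)
  have csym: "christoffel1 g P i j k = christoffel1 g P j i k" for i j k
    unfolding christoffel1_def by (subst eq[of i j]) (simp only: add.commute)
  have "(\<Sum>i\<in>UNIV. \<Sum>j\<in>UNIV. christoffel1 g P i j k * v $ i * w $ j)
      = (\<Sum>i\<in>UNIV. \<Sum>j\<in>UNIV. christoffel1 g P i j k * w $ i * v $ j)" for k v w
    by (subst sum.swap, intro sum.cong refl, subst csym) simp
  then show ?thesis
    by (simp add: nabla_def bracket_def christoffel_def)
qed

lemma nabla_metric:
  assumes g: "pseudo_riemannian g"
    and \<eta>: "\<eta> differentiable (at P)" and \<zeta>: "\<zeta> differentiable (at P)"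
  shows "dird (\<lambda>Q. bform (g Q) (\<eta> Q) (\<zeta> Q)) P (\<xi> P)
    = bform (g P) (nabla g \<xi> \<eta> P) (\<zeta> P) + bform (g P) (\<eta> P) (nabla g \<xi> \<zeta> P)"
proof -
  let ?v = "\<xi> P"
  have sym: "g Q $ i $ j = g Q $ j $ i" for Q i j
    using g by (rule metric_sym)
  have tr: "transpose (g P) = g P" and "invertible (g P)"
    using g by (auto simp: pseudo_riemannian_def)
  then have inv: "g P ** matrix_inv (g P) = mat 1"
    unfolding matrix_inv_def invertible_def by (metis (mono_tags, lifting) someI_ex)
  have bcom: "bform (g P) a b = bform (g P) b a" for a b
    unfolding bform_def by (subst inner_commute, subst (2) tr[symmetric]) (simp add: dot_lmul_matrix)
  have chr: "bform (g P) u (christoffel g P v w)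
      = (\<Sum>k\<in>UNIV. u $ k * (\<Sum>i\<in>UNIV. \<Sum>j\<in>UNIV. christoffel1 g P i j k * v $ i * w $ j))" for u v w
    by (simp add: bform_def christoffel_def matrix_vector_mul_assoc inv inner_vec_def)
  have dg: "((\<lambda>Q. g Q $ i $ j) has_derivative (dird (\<lambda>Q. g Q $ i $ j) P)) (at P)" for i j
  proof -
    have "Ck (Suc 0) (\<lambda>Q. g Q $ i $ j)"
      using g unfolding pseudo_riemannian_def smooth_def by blast
    then have "(\<lambda>Q. g Q $ i $ j) differentiable (at P)" by simp
    then show ?thesis by (simp add: frechet_derivative_works dird_def[abs_def])
  qed
  have dd: "dird (\<lambda>Q. g Q $ i $ j) P v = (\<Sum>k\<in>UNIV. v $ k * dird (\<lambda>Q. g Q $ i $ j) P (axis k 1))"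
    for i j v
  proof -
    have l: "linear (dird (\<lambda>Q. g Q $ i $ j) P)"
      using dg has_derivative_linear by blast
    have "dird (\<lambda>Q. g Q $ i $ j) P (\<Sum>k\<in>UNIV. v $ k *\<^sub>R axis k 1)
        = (\<Sum>k\<in>UNIV. v $ k * dird (\<lambda>Q. g Q $ i $ j) P (axis k 1))"
      by (simp add: linear_sum[OF l] linear_scale[OF l])
    moreover have "(\<Sum>k\<in>UNIV. v $ k *\<^sub>R axis k 1) = v"
      using basis_expansion[of v] by (simp add: scalar_mult_eq_scaleR)
    ultimately show ?thesis by simp
  qed
  have d\<eta>: "(\<eta> has_derivative dird \<eta> P) (at P)" and d\<zeta>: "(\<zeta> has_derivative dird \<zeta> P) (at P)"
    using \<eta> \<zeta> by (simp_all add: frechet_derivative_works dird_def[abs_def])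
  have bexp: "bform A a b = (\<Sum>i\<in>UNIV. \<Sum>j\<in>UNIV. A $ i $ j * a $ i * b $ j)" for A and a b :: "real ^ 'a"
    by (simp add: bform_def inner_vec_def matrix_vector_mult_def sum_distrib_left mult_ac)
  have "((\<lambda>Q. bform (g Q) (\<eta> Q) (\<zeta> Q)) has_derivative
     (\<lambda>h. \<Sum>i\<in>UNIV. \<Sum>j\<in>UNIV. g P $ i $ j * \<eta> P $ i * dird \<zeta> P h $ j
        + (g P $ i $ j * dird \<eta> P h $ i + dird (\<lambda>Q. g Q $ i $ j) P h * \<eta> P $ i) * \<zeta> P $ j)) (at P)"
    unfolding bexp
    by (intro has_derivative_sum has_derivative_mult dg
        bounded_linear.has_derivative[OF bounded_linear_vec_nth] d\<eta> d\<zeta>)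
  note D = this
  have "dird (\<lambda>Q. bform (g Q) (\<eta> Q) (\<zeta> Q)) P ?v
     = (\<Sum>i\<in>UNIV. \<Sum>j\<in>UNIV. g P $ i $ j * \<eta> P $ i * dird \<zeta> P ?v $ j
        + (g P $ i $ j * dird \<eta> P ?v $ i + dird (\<lambda>Q. g Q $ i $ j) P ?v * \<eta> P $ i) * \<zeta> P $ j)"
    by (simp only: dird_def[of "\<lambda>Q. bform (g Q) (\<eta> Q) (\<zeta> Q)"] frechet_derivative_at[OF D, symmetric])
  also have "\<dots> = bform (g P) (dird \<eta> P ?v) (\<zeta> P) + bform (g P) (\<eta> P) (dird \<zeta> P ?v)
     + (\<Sum>i\<in>UNIV. \<Sum>j\<in>UNIV. dird (\<lambda>Q. g Q $ i $ j) P ?v * \<eta> P $ i * \<zeta> P $ j)"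
    unfolding bexp by (simp only: sum.distrib[symmetric]) (intro sum.cong refl, simp add: algebra_simps)
  also have "(\<Sum>i\<in>UNIV. \<Sum>j\<in>UNIV. dird (\<lambda>Q. g Q $ i $ j) P ?v * \<eta> P $ i * \<zeta> P $ j)
     = (\<Sum>i\<in>UNIV. \<Sum>j\<in>UNIV. \<Sum>k\<in>UNIV.
          (christoffel1 g P k i j + christoffel1 g P k j i) * ?v $ k * \<eta> P $ i * \<zeta> P $ j)"
  proof -
    have eq: "(\<lambda>Q. g Q $ i $ j) = (\<lambda>Q. g Q $ j $ i)" for i j
      by (rule ext) (rule sym)
    have "christoffel1 g P k i j + christoffel1 g P k j i = dird (\<lambda>Q. g Q $ i $ j) P (axis k 1)" for i j k
      unfolding christoffel1_def by (subst eq[of j i]) (simp add: field_simps)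
    then show ?thesis
      by (subst dd, intro sum.cong refl) (simp add: sum_distrib_left mult_ac)
  qed
  also have "\<dots> = bform (g P) (christoffel g P ?v (\<eta> P)) (\<zeta> P) + bform (g P) (\<eta> P) (christoffel g P ?v (\<zeta> P))"
  proof -
    have "(\<Sum>i\<in>UNIV. \<Sum>j\<in>UNIV. \<Sum>k\<in>UNIV. christoffel1 g P k i j * ?v $ k * \<eta> P $ i * \<zeta> P $ j)
        = bform (g P) (\<zeta> P) (christoffel g P ?v (\<eta> P))"
      unfolding chr sum_distrib_left
      by (subst sum.swap, rule sum.cong[OF refl], subst sum.swap, intro sum.cong refl) simp
    moreover have "(\<Sum>i\<in>UNIV. \<Sum>j\<in>UNIV. \<Sum>k\<in>UNIV. christoffel1 g P k j i * ?v $ k * \<eta> P $ i * \<zeta> P $ j)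
        = bform (g P) (\<eta> P) (christoffel g P ?v (\<zeta> P))"
      unfolding chr sum_distrib_left
      by (rule sum.cong[OF refl], subst sum.swap, intro sum.cong refl) simp
    ultimately show ?thesis
      using bcom[of "christoffel g P ?v (\<eta> P)" "\<zeta> P"] by (simp add: sum.distrib distrib_right)
  qed
  finally show ?thesis
    by (simp add: nabla_def bform_def inner_add_left matrix_vector_right_distrib inner_add_right)
qed

definition curv :: "'a::finite metric \<Rightarrow> 'a vfield \<Rightarrow> 'a vfield \<Rightarrow> 'a vfield \<Rightarrow> 'a vfield \<Rightarrow> real ^ 'a \<Rightarrow> real"
  where "curv g \<xi>1 \<xi>2 \<xi>3 \<xi>4 = (\<lambda>P.
    bform (g P)
      (nabla g \<xi>1 (nabla g \<xi>2 \<xi>3) P - nabla g \<xi>2 (nabla g \<xi>1 \<xi>3) P - nabla g (bracket \<xi>1 \<xi>2) \<xi>3 P)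
      (\<xi>4 P))"

text \<open>A covariant tensor field takes a point and the list of its vector arguments. Tensors are
  evaluated on tangent vectors by extending these to constant (coordinate) vector fields. In
  \<open>\<nabla>T\<close> the direction of differentiation is the last argument.\<close>

definition curv_tensor :: "'a::finite metric \<Rightarrow> real ^ 'a \<Rightarrow> (real ^ 'a) list \<Rightarrow> real"
  where "curv_tensor g P vs =
    curv g (\<lambda>_. vs ! 0) (\<lambda>_. vs ! 1) (\<lambda>_. vs ! 2) (\<lambda>_. vs ! 3) P"

definition cov_deriv ::
  "'a::finite metric \<Rightarrow> (real ^ 'a \<Rightarrow> (real ^ 'a) list \<Rightarrow> real) \<Rightarrow> real ^ 'a \<Rightarrow> (real ^ 'a) list \<Rightarrow> real"
  where "cov_deriv g T P vs =
    (let us = butlast vs; v = last vs in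
      dird (\<lambda>Q. T Q us) P v
        - (\<Sum>i<length us. T P (us[i := nabla g (\<lambda>_. v) (\<lambda>_. us ! i) P])))"

definition nabla_curv :: "'a::finite metric \<Rightarrow> nat \<Rightarrow> real ^ 'a \<Rightarrow> (real ^ 'a) list \<Rightarrow> real"
  where "nabla_curv g i = (cov_deriv g ^^ i) (curv_tensor g)"


subsection \<open>Isometries, homogeneous and symmetric spaces, models\<close>

definition isometry :: "'a::finite metric \<Rightarrow> 'b::finite metric \<Rightarrow> (real ^ 'a \<Rightarrow> real ^ 'b) \<Rightarrow> bool"
  where "isometry g h \<phi> \<longleftrightarrow>
    bij \<phi> \<and> smooth_map \<phi> \<and> smooth_map (inv \<phi>) \<and>
    (\<forall>P v w. bform (h (\<phi> P)) (dird \<phi> P v) (dird \<phi> P w) = bform (g P) v w)"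

definition homogeneous :: "'a::finite metric \<Rightarrow> bool"
  where "homogeneous g \<longleftrightarrow> pseudo_riemannian g \<and> (\<forall>P Q. \<exists>\<phi>. isometry g g \<phi> \<and> \<phi> P = Q)"

text \<open>Globally symmetric: at every point there is an isometry that fixes the point and has
  differential \<open>-id\<close> there (the geodesic symmetry). Connectedness is automatic.\<close>

definition symmetric_space :: "'a::finite metric \<Rightarrow> bool"
  where "symmetric_space g \<longleftrightarrow> pseudo_riemannian g \<and>
    (\<forall>P. \<exists>\<phi>. isometry g g \<phi> \<and> \<phi> P = P \<and> (\<forall>v. dird \<phi> P v = - v))"

definition model_iso ::
  "nat \<Rightarrow> 'a::finite metric \<Rightarrow> real ^ 'a \<Rightarrow> 'b::finite metric \<Rightarrow> real ^ 'b \<Rightarrow> (real ^ 'a \<Rightarrow> real ^ 'b) \<Rightarrow> bool"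
  where "model_iso k g P h Q L \<longleftrightarrow>
    linear L \<and> bij L \<and>
    (\<forall>v w. bform (h Q) (L v) (L w) = bform (g P) v w) \<and>
    (\<forall>i\<le>k. \<forall>vs. length vs = 4 + i \<longrightarrow> nabla_curv h i Q (map L vs) = nabla_curv g i P vs)"

definition modeled_on :: "nat \<Rightarrow> 'a::finite metric \<Rightarrow> 'b::finite metric \<Rightarrow> bool"
  where "modeled_on k g h \<longleftrightarrow>
    pseudo_riemannian g \<and> homogeneous h \<and> (\<forall>P Q. \<exists>L. model_iso k g P h Q L)"


subsection \<open>Holonomy and indecomposability\<close>

definition parallel_along :: "'a::finite metric \<Rightarrow> (real \<Rightarrow> real ^ 'a) \<Rightarrow> (real \<Rightarrow> real ^ 'a) \<Rightarrow> bool"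
  where "parallel_along g \<gamma> V \<longleftrightarrow>
    (\<forall>t\<in>{0..1}. (V has_vector_derivative
       - christoffel g (\<gamma> t) (vector_derivative \<gamma> (at t)) (V t)) (at t within {0..1}))"

text \<open>The holonomy group at \<open>P\<close>: all parallel transports around loops based at \<open>P\<close>. The loops are
  \<open>C\<^sup>1\<close> without any condition relating the velocities at the two ends. Piecewise \<open>C\<^sup>1\<close> loops give
  nothing more, since they can be reparametrised so as to stop at the corners.\<close>

definition holonomy :: "'a::finite metric \<Rightarrow> real ^ 'a \<Rightarrow> (real ^ 'a \<Rightarrow> real ^ 'a) set"
  where "holonomy g P = {T. \<exists>\<gamma>. \<gamma> C1_differentiable_on {0..1} \<and> \<gamma> 0 = P \<and> \<gamma> 1 = P \<and>
    (\<forall>v. \<exists>V. parallel_along g \<gamma> V \<and> V 0 = v \<and> V 1 = T v)}"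

text \<open>A decomposition is an orthogonal direct sum, as usual for pseudo-Riemannian manifolds. Its
  summands are then automatically non-degenerate.\<close>

definition decomposition :: "real ^ 'a ^ 'a \<Rightarrow> (real ^ 'a::finite) set \<Rightarrow> (real ^ 'a) set \<Rightarrow> bool"
  where "decomposition A U W \<longleftrightarrow>
    subspace U \<and> subspace W \<and> U \<inter> W = {0} \<and> (\<forall>v. \<exists>u\<in>U. \<exists>w\<in>W. v = u + w) \<and>
    (\<forall>u\<in>U. \<forall>w\<in>W. bform A u w = 0)"

definition indecomposable :: "'a::finite metric \<Rightarrow> bool"
  where "indecomposable g \<longleftrightarrow> (\<forall>P. \<not> (\<exists>U W. decomposition (g P) U W \<and> U \<noteq> {0} \<and> W \<noteq> {0} \<and>
    (\<forall>T\<in>holonomy g P. T ` U \<subseteq> U \<and> T ` W \<subseteq> W)))"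


section \<open>The manifolds \<open>\<M>\<^bsub>6+4p,f\<^esub>\<close>\<close>

text \<open>The index set \<open>{0,\<dots>,p}\<close> is a finite type \<open>'n\<close> with \<open>p + 1\<close> elements. The constructors
  index the coordinates \<open>x\<close>, \<open>z\<^sub>i\<close>, \<open>z\<^sub>i\<close> with tilde, and the dual coordinates
  \<open>x\<^sup>*\<close>, \<open>z\<^sub>i\<^sup>*\<close>, \<open>z\<^sub>i\<^sup>*\<close> with tilde.\<close>

datatype 'n coord = Xc | Zc 'n | Ztc 'n | Xs | Zs 'n | Zts 'n

lemma UNIV_coord:
  "(UNIV :: 'n coord set) = {Xc, Xs} \<union> range Zc \<union> range Ztc \<union> range Zs \<union> range Zts"
  by (auto, metis coord.exhaust rangeI)

instance coord :: (finite) finite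
  by standard (simp add: UNIV_coord)

lemma CARD_coord: "CARD('n::finite coord) = 2 + 4 * CARD('n)"
proof -
  define A B C D :: "'n coord set"
    where defs: "A = range Zc" "B = range Ztc" "C = range Zs" "D = range Zts"
  have "card A = CARD('n)" "card B = CARD('n)" "card C = CARD('n)" "card D = CARD('n)"
    unfolding defs by (simp_all add: card_image inj_def)
  moreover have "A \<inter> B = {}" "(A \<union> B) \<inter> C = {}" "(A \<union> B \<union> C) \<inter> D = {}" "Xc \<notin> A \<union> B \<union> C \<union> D" "Xs \<notin> A \<union> B \<union> C \<union> D"
    unfolding defs by auto
  ultimately have "card (insert Xc (insert Xs (A \<union> B \<union> C \<union> D))) = 2 + 4 * CARD('n)"
    by (simp add: card_Un_disjoint)
  moreover have "UNIV = insert Xc (insert Xs (A \<union> B \<union> C \<union> D))"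
    unfolding defs UNIV_coord by blast
  ultimately show ?thesis
    by (simp only:)
qed

fun metric_comp :: "(real ^ 'n::finite \<Rightarrow> real) \<Rightarrow> real ^ ('n coord) \<Rightarrow> 'n coord \<Rightarrow> 'n coord \<Rightarrow> real" where
  "metric_comp f P Xc Xc = - 2 * (f (\<chi> i. P $ Zc i) + (\<Sum>i\<in>UNIV. P $ Zc i * P $ Ztc i))"
| "metric_comp f P Xc Xs = 1"
| "metric_comp f P Xs Xc = 1"
| "metric_comp f P (Zc i) (Zs j) = (if i = j then 1 else 0)"
| "metric_comp f P (Zs i) (Zc j) = (if i = j then 1 else 0)"
| "metric_comp f P (Ztc i) (Zts j) = (if i = j then 1 else 0)"
| "metric_comp f P (Zts i) (Ztc j) = (if i = j then 1 else 0)"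
| "metric_comp f P _ _ = 0"

definition M_metric :: "(real ^ 'n::finite \<Rightarrow> real) \<Rightarrow> 'n coord metric"
  where "M_metric f P = (\<chi> a b. metric_comp f P a b)"

definition S_metric :: "'n::finite coord metric"
  where "S_metric = M_metric (\<lambda>_. 0)"

end

theory Submission
  imports Defs
begin

text \<open>Write \<open>y = (z, z~)\<close>, \<open>\<phi> = f(z) + \<Sum> z\<^sub>i z~\<^sub>i\<close>, so that \<open>g(\<partial>\<^sub>x,\<partial>\<^sub>x) = - 2 \<phi>\<close>. The Christoffel symbols take
  values in the span of the dual coordinate fields and vanish on it, so the curvature is linear in the
  Hessian of \<open>\<phi>\<close>: it is determined by \<open>R(\<partial>\<^sub>x, u, v, \<partial>\<^sub>x)\<close>, which up to sign is \<open>Hess \<phi> (u, v)\<close>. As the Hessian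
  of \<open>\<Sum> z\<^sub>i z~\<^sub>i\<close> pairs \<open>z\<close> with \<open>z~\<close>, the shear \<open>z~ \<mapsto> z~ + Hess f (z) / 2\<close>, completed to an
  isometry of the tangent spaces on the dual coordinates, absorbs \<open>Hess f\<close>; this gives the 0-model.

  For \<open>f = 0\<close>, explicit polynomial isometries act transitively and contain the geodesic symmetries.
  Parallel transport can be integrated explicitly, and suitable loops realise all transvections
  \<open>v \<mapsto> v + B(c,v) \<partial>\<^bsub>x*\<^esub> - v\<^sub>x c\<^sup>#\<close>. If \<open>U \<oplus> W\<close> is an invariant orthogonal decomposition and \<open>u \<in> U\<close> has
  \<open>u\<^sub>x \<noteq> 0\<close>, comparing the transvections of \<open>u\<close> with \<open>W\<close> forces \<open>W\<close> into the totally isotropic span of the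
  dual directions; then \<open>W\<close> is orthogonal to everything, so it is zero.\<close>

section \<open>Smooth functions and the symmetry of the Hessian\<close>

lemma dird_eq: "(F has_derivative F') (at P) \<Longrightarrow> dird F P = F'"
  unfolding dird_def by (auto simp: fun_eq_iff frechet_derivative_at[symmetric])

lemma has_derivative_dird: "F differentiable (at P) \<Longrightarrow> (F has_derivative dird F P) (at P)"
  by (simp add: frechet_derivative_works dird_def[abs_def])

lemma dird_const [simp]: "dird (\<lambda>_. c) P v = 0"
  by (simp add: dird_def)

lemma dird_nth [simp]: "dird (\<lambda>P. P $ i) P v = v $ i"
  by (subst dird_eq[of _ "\<lambda>v. v $ i"]) (auto intro!: bounded_linear_imp_has_derivative bounded_linear_vec_nth)

lemma linear_dird: "F differentiable (at P) \<Longrightarrow> linear (dird F P)"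
  using has_derivative_dird has_derivative_linear by blast

lemma dird_axis_expansion:
  fixes F :: "real ^ 'a::finite \<Rightarrow> real"
  assumes "F differentiable (at P)"
  shows "dird F P v = (\<Sum>i\<in>UNIV. v $ i * dird F P (axis i 1))"
proof -
  note l = linear_dird[OF assms]
  have "dird F P (\<Sum>i\<in>UNIV. v $ i *\<^sub>R axis i 1) = (\<Sum>i\<in>UNIV. v $ i * dird F P (axis i 1))"
    by (simp add: linear_sum[OF l] linear_scale[OF l])
  then show ?thesis
    using basis_expansion[of v] by (simp add: scalar_mult_eq_scaleR)
qed

lemma has_derivative_vec:
  fixes F :: "'x::real_normed_vector \<Rightarrow> real ^ 'k::finite"
  assumes "\<And>k. ((\<lambda>P. F P $ k) has_derivative (\<lambda>v. F' v $ k)) (at P within S)"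
  shows "(F has_derivative F') (at P within S)"
  unfolding has_derivative_componentwise_within[of F]
  using assms by (auto simp: Basis_vec_def cart_eq_inner_axis)

section \<open>Closure properties of smooth functions\<close>

lemma Ck_imp_continuous_on: "Ck k F \<Longrightarrow> continuous_on UNIV F"
  by (cases k) (auto intro!: differentiable_imp_continuous_on simp: differentiable_on_def
      differentiable_at_withinI)

lemma Ck_SucD: "Ck (Suc k) F \<Longrightarrow> Ck k F"
proof (induction k arbitrary: F)
  case 0
  then show ?case using Ck_imp_continuous_on Ck.simps(1) by blast
next
  case (Suc k)
  then show ?case using Ck.simps(2) by blast
qed

lemma Ck_const: "Ck k (\<lambda>_. c)"
  by (induction k arbitrary: c) auto

lemma Ck_nth: "Ck k (\<lambda>P. P $ i)"
  by (cases k) (auto intro!: Ck_const continuous_intros bounded_linear_imp_differentiable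
      bounded_linear_vec_nth)

lemma Ck_add: "Ck k F \<Longrightarrow> Ck k G \<Longrightarrow> Ck k (\<lambda>P. F P + G P)"
proof (induction k arbitrary: F G)
  case (Suc k)
  then have "dird (\<lambda>P. F P + G P) P v = dird F P v + dird G P v" for P v
    by (subst dird_eq[OF has_derivative_add]) (auto intro!: has_derivative_dird)
  with Suc show ?case by auto
qed (auto intro: continuous_on_add)

lemma Ck_mult: "Ck k F \<Longrightarrow> Ck k G \<Longrightarrow> Ck k (\<lambda>P. F P * G P)"
proof (induction k arbitrary: F G)
  case (Suc k)
  then have "dird (\<lambda>P. F P * G P) P v = F P * dird G P v + dird F P v * G P" for P v
    by (subst dird_eq[OF has_derivative_mult]) (auto intro!: has_derivative_dird)
  with Suc Ck_SucD[OF Suc.prems(1)] Ck_SucD[OF Suc.prems(2)] show ?case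
    by (auto intro!: Ck_add)
qed (auto intro: continuous_on_mult)

lemma smooth_const: "smooth (\<lambda>_. c)"
  and smooth_nth: "smooth (\<lambda>P. P $ i)"
  and smooth_add: "smooth F \<Longrightarrow> smooth G \<Longrightarrow> smooth (\<lambda>P. F P + G P)"
  and smooth_mult: "smooth F \<Longrightarrow> smooth G \<Longrightarrow> smooth (\<lambda>P. F P * G P)"
  unfolding smooth_def by (auto intro: Ck_const Ck_nth Ck_add Ck_mult)

lemma smooth_diff: "smooth F \<Longrightarrow> smooth G \<Longrightarrow> smooth (\<lambda>P. F P - G P)"
  using smooth_add[OF _ smooth_mult[OF smooth_const], of F G "-1"] by simp

lemma smooth_divide: "smooth F \<Longrightarrow> smooth (\<lambda>P. F P / c)"
  using smooth_mult[OF _ smooth_const, of F "inverse c"] by (simp add: divide_inverse)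

lemma smooth_sum: "(\<And>i. i \<in> I \<Longrightarrow> smooth (F i)) \<Longrightarrow> smooth (\<lambda>P. \<Sum>i\<in>I. F i P)"
  by (induction I rule: infinite_finite_induct) (auto intro: smooth_const smooth_add)

lemmas smooth_intros = smooth_const smooth_nth smooth_add smooth_mult smooth_diff smooth_divide smooth_sum

lemma smooth_differentiable: "smooth F \<Longrightarrow> F differentiable (at P)"
  unfolding smooth_def by (metis Ck.simps(2))

lemma smooth_dird:
  assumes "smooth F"
  shows "smooth (\<lambda>Q. dird F Q v)"
proof -
  \<comment> \<open>\<open>Ck\<close> controls derivatives along the coordinate axes only, so the
    direction \<open>v\<close> is first expanded in the frame.\<close>
  have "(\<lambda>Q. dird F Q v) = (\<lambda>Q. \<Sum>i\<in>UNIV. v $ i * dird F Q (axis i 1))"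
    by (intro ext dird_axis_expansion smooth_differentiable assms)
  moreover have "smooth (\<lambda>Q. dird F Q (axis i 1))" for i
    using assms unfolding smooth_def by (metis Ck.simps(2))
  ultimately show ?thesis by (auto intro!: smooth_intros)
qed

text \<open>The mean value theorem is used twice: along \<open>u\<close> for the increment of
  \<open>f\<close> under the shift by \<open>h *\<^sub>R v\<close>, then along \<open>v\<close> for
  \<open>fu\<close>.\<close>

lemma second_difference_mean_value:
  fixes f :: "'x::real_normed_vector \<Rightarrow> real"
  assumes u: "\<And>Q. ((\<lambda>t. f (Q + t *\<^sub>R u)) has_real_derivative fu Q) (at 0)"
    and uv: "\<And>Q. ((\<lambda>t. fu (Q + t *\<^sub>R v)) has_real_derivative fuv Q) (at 0)"
    and h: "h > 0"
  shows "\<exists>a b. 0 < a \<and> a < h \<and> 0 < b \<and> b < h \<and>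
    f (P + h *\<^sub>R u + h *\<^sub>R v) - f (P + h *\<^sub>R u) - f (P + h *\<^sub>R v) + f P
      = h * h * fuv (P + a *\<^sub>R u + b *\<^sub>R v)"
proof -
  \<comment> \<open>The hypotheses give the derivative at parameter 0 for every base point; moving
    the base point along the line gives it at every parameter.\<close>
  have shift: "((\<lambda>t. F (Q + t *\<^sub>R w)) has_real_derivative F' (Q + s *\<^sub>R w)) (at s)"
    if "\<And>Q. ((\<lambda>t. F (Q + t *\<^sub>R w)) has_real_derivative F' Q) (at 0)"
    for F F' Q and w :: 'x and s
  proof -
    have "(\<lambda>t. F (Q + s *\<^sub>R w + t *\<^sub>R w)) = (\<lambda>t. F (Q + (t + s) *\<^sub>R w))"
      by (simp only: scaleR_add_left ac_simps)
    with that[of "Q + s *\<^sub>R w"] show ?thesis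
      by (simp only: DERIV_shift[of "\<lambda>t. F (Q + t *\<^sub>R w)" _ 0 s, symmetric] add_0)
  qed
  define G where "G s = f (P + h *\<^sub>R v + s *\<^sub>R u) - f (P + s *\<^sub>R u)" for s
  have "(G has_real_derivative fu (P + h *\<^sub>R v + s *\<^sub>R u) - fu (P + s *\<^sub>R u)) (at s)" for s
    unfolding G_def by (intro DERIV_diff shift[where F=f and F'=fu and w=u, OF u])
  then obtain a where a: "0 < a" "a < h"
    "G h - G 0 = h * (fu (P + h *\<^sub>R v + a *\<^sub>R u) - fu (P + a *\<^sub>R u))"
    using MVT2[of 0 h G "\<lambda>s. fu (P + h *\<^sub>R v + s *\<^sub>R u) - fu (P + s *\<^sub>R u)"] h by auto
  obtain b where b: "0 < b" "b < h"
    "fu (P + a *\<^sub>R u + h *\<^sub>R v) - fu (P + a *\<^sub>R u) = h * fuv (P + a *\<^sub>R u + b *\<^sub>R v)"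
    using MVT2[of 0 h "\<lambda>t. fu (P + a *\<^sub>R u + t *\<^sub>R v)" "\<lambda>t. fuv (P + a *\<^sub>R u + t *\<^sub>R v)"]
      shift[where F=fu and F'=fuv and w=v, OF uv] h by auto
  show ?thesis
    using a b by (intro exI[of _ a] exI[of _ b]) (auto simp: G_def algebra_simps)
qed

text \<open>The mixed second difference is symmetric in \<open>u\<close> and \<open>v\<close>, so
  its two mean value forms agree. As the parallelogram shrinks to \<open>P\<close>, continuity turns
  this into equality at \<open>P\<close>.\<close>

lemma schwarz_symmetry:
  fixes f :: "'x::real_normed_vector \<Rightarrow> real"
  assumes u: "\<And>Q. ((\<lambda>t. f (Q + t *\<^sub>R u)) has_real_derivative fu Q) (at 0)"
    and uv: "\<And>Q. ((\<lambda>t. fu (Q + t *\<^sub>R v)) has_real_derivative fuv Q) (at 0)"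
    and v: "\<And>Q. ((\<lambda>t. f (Q + t *\<^sub>R v)) has_real_derivative fv Q) (at 0)"
    and vu: "\<And>Q. ((\<lambda>t. fv (Q + t *\<^sub>R u)) has_real_derivative fvu Q) (at 0)"
    and cont: "isCont fuv P" "isCont fvu P"
  shows "fuv P = fvu P"
proof -
  have "\<bar>fuv P - fvu P\<bar> \<le> e" if e: "e > 0" for e
  proof -
    obtain d1 where d1: "d1 > 0" "\<And>Q. norm (Q - P) < d1 \<Longrightarrow> \<bar>fuv Q - fuv P\<bar> < e / 2"
      using cont(1)[unfolded continuous_at_eps_delta dist_norm real_norm_def]
        half_gt_zero[OF e] by blast
    obtain d2 where d2: "d2 > 0" "\<And>Q. norm (Q - P) < d2 \<Longrightarrow> \<bar>fvu Q - fvu P\<bar> < e / 2"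
      using cont(2)[unfolded continuous_at_eps_delta dist_norm real_norm_def]
        half_gt_zero[OF e] by blast
    define d where "d = min d1 d2"
    \<comment> \<open>This size keeps the intermediate points of both mean value forms within
      \<open>d\<close> of \<open>P\<close>; the summand 1 keeps the denominator positive when
      \<open>u = v = 0\<close>.\<close>
    define h where "h = d / (norm u + norm v + 1)"
    have "d > 0" "norm u + norm v + 1 > 0"
      using d1 d2 by (auto simp: d_def add_nonneg_pos)
    then have h: "h > 0" "h * (norm u + norm v) < d"
      by (auto simp: h_def field_simps)
    have near: "norm (P + a *\<^sub>R u + b *\<^sub>R v - P) < d" if "0 < a" "a < h" "0 < b" "b < h" for a b
    proof -
      have "norm (a *\<^sub>R u + b *\<^sub>R v) \<le> a * norm u + b * norm v"
        using that by (intro order.trans[OF norm_triangle_ineq]) simp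
      also have "\<dots> \<le> h * norm u + h * norm v"
        using that by (intro add_mono mult_right_mono) auto
      finally show ?thesis using h(2) by (simp add: algebra_simps)
    qed
    obtain a b where ab: "0 < a" "a < h" "0 < b" "b < h"
      "f (P + h *\<^sub>R u + h *\<^sub>R v) - f (P + h *\<^sub>R u) - f (P + h *\<^sub>R v) + f P
        = h * h * fuv (P + a *\<^sub>R u + b *\<^sub>R v)"
      using second_difference_mean_value[OF u uv h(1)] by blast
    obtain a' b' where ab': "0 < a'" "a' < h" "0 < b'" "b' < h"
      "f (P + h *\<^sub>R v + h *\<^sub>R u) - f (P + h *\<^sub>R v) - f (P + h *\<^sub>R u) + f P
        = h * h * fvu (P + a' *\<^sub>R v + b' *\<^sub>R u)"
      using second_difference_mean_value[OF v vu h(1)] by blast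
    have comm: "P + h *\<^sub>R v + h *\<^sub>R u = P + h *\<^sub>R u + h *\<^sub>R v"
      "P + a' *\<^sub>R v + b' *\<^sub>R u = P + b' *\<^sub>R u + a' *\<^sub>R v"
      by simp_all
    have "h * h * fuv (P + a *\<^sub>R u + b *\<^sub>R v) = h * h * fvu (P + b' *\<^sub>R u + a' *\<^sub>R v)"
      using ab(5) ab'(5) unfolding comm by linarith
    with h(1) have "fuv (P + a *\<^sub>R u + b *\<^sub>R v) = fvu (P + b' *\<^sub>R u + a' *\<^sub>R v)"
      by simp
    with d1(2)[of "P + a *\<^sub>R u + b *\<^sub>R v"] d2(2)[of "P + b' *\<^sub>R u + a' *\<^sub>R v"]
      near[OF ab(1-4)] near[OF ab'(3,4,1,2)]
    show ?thesis unfolding d_def by linarith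
  qed
  then have "\<bar>fuv P - fvu P\<bar> \<le> 0"
    by (rule field_le_epsilon) simp
  then show ?thesis by simp
qed

definition hess :: "(real ^ 'a::finite \<Rightarrow> real) \<Rightarrow> real ^ 'a \<Rightarrow> real ^ 'a \<Rightarrow> real ^ 'a \<Rightarrow> real"
  where "hess F P u v = dird (\<lambda>Q. dird F Q v) P u"

lemma has_real_derivative_dird:
  fixes F :: "real ^ 'a::finite \<Rightarrow> real"
  assumes "F differentiable (at Q)"
  shows "((\<lambda>t. F (Q + t *\<^sub>R u)) has_real_derivative dird F Q u) (at 0)"
proof -
  have "((\<lambda>t. F (Q + t *\<^sub>R u)) has_derivative (\<lambda>t. dird F Q (t *\<^sub>R u))) (at 0)"
    by (rule has_derivative_compose[of "\<lambda>t. Q + t *\<^sub>R u" _ _ _ F])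
      (auto intro!: derivative_eq_intros has_derivative_dird assms)
  moreover have "(\<lambda>t. dird F Q (t *\<^sub>R u)) = (*) (dird F Q u)"
    by (simp add: fun_eq_iff linear_scale[OF linear_dird[OF assms]])
  ultimately show ?thesis by (simp add: has_field_derivative_def)
qed

lemma hess_sym:
  assumes "smooth F"
  shows "hess F P u v = hess F P v u"
proof -
  have smooth_hess: "smooth (\<lambda>P. hess F P u v)" for u v
    unfolding hess_def by (intro smooth_dird assms)
  show ?thesis
    by (rule schwarz_symmetry[of F v "\<lambda>Q. dird F Q v" u "\<lambda>P. hess F P u v" "\<lambda>Q. dird F Q u"])
      (auto simp: hess_def intro!: has_real_derivative_dird smooth_differentiable smooth_dird assms
        differentiable_imp_continuous_within)
qed

lemma linear_hess: "smooth F \<Longrightarrow> linear (\<lambda>u. hess F P u v)"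
  unfolding hess_def by (intro linear_dird smooth_differentiable smooth_dird)

lemma hess_axis_expansion:
  "smooth F \<Longrightarrow> hess F P u v = (\<Sum>i\<in>UNIV. u $ i * hess F P (axis i 1) v)"
  unfolding hess_def by (intro dird_axis_expansion smooth_differentiable smooth_dird)


section \<open>The metric and its Levi-Civita connection\<close>

lemma sum_coord:
  fixes F :: "'n::finite coord \<Rightarrow> 'b::comm_monoid_add"
  shows "(\<Sum>k\<in>UNIV. F k) = F Xc + F Xs +
    ((\<Sum>i\<in>UNIV. F (Zc i)) + (\<Sum>i\<in>UNIV. F (Ztc i)) + (\<Sum>i\<in>UNIV. F (Zs i)) + (\<Sum>i\<in>UNIV. F (Zts i)))"
proof -
  define S where "S = range (Zc :: 'n \<Rightarrow> _) \<union> range Ztc \<union> range Zs \<union> range Zts"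
  have "inj (Zc :: 'n \<Rightarrow> _)" "inj (Ztc :: 'n \<Rightarrow> _)" "inj (Zs :: 'n \<Rightarrow> _)" "inj (Zts :: 'n \<Rightarrow> _)"
    by (auto simp: inj_def)
  then have "sum F S = (\<Sum>i\<in>UNIV. F (Zc i)) + (\<Sum>i\<in>UNIV. F (Ztc i)) + (\<Sum>i\<in>UNIV. F (Zs i))
      + (\<Sum>i\<in>UNIV. F (Zts i))"
    unfolding S_def by (subst sum.union_disjoint, simp, simp, blast)+ (simp add: sum.reindex)
  moreover have "sum F (insert Xc (insert Xs S)) = F Xc + F Xs + sum F S"
    by (subst sum.insert; (subst sum.insert)?) (auto simp: S_def add.assoc)
  moreover have "(UNIV :: 'n coord set) = insert Xc (insert Xs S)"
    unfolding S_def UNIV_coord by auto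
  ultimately show ?thesis by (simp only:)
qed

definition zpart :: "real ^ 'n::finite coord \<Rightarrow> real ^ 'n"
  where "zpart P = (\<chi> i. P $ Zc i)"

text \<open>The polar form of the quadratic form given by the sum of the products of z_i and z~_i;
  it is also the constant Hessian of that form.\<close>

definition pairing :: "real ^ 'n::finite coord \<Rightarrow> real ^ 'n coord \<Rightarrow> real"
  where "pairing v w = (\<Sum>i\<in>UNIV. v $ Zc i * w $ Ztc i + v $ Ztc i * w $ Zc i)"

definition potential :: "(real ^ 'n::finite \<Rightarrow> real) \<Rightarrow> real ^ 'n coord \<Rightarrow> real"
  where "potential f P = f (zpart P) + (\<Sum>i\<in>UNIV. P $ Zc i * P $ Ztc i)"

lemma pairing_commute: "pairing v w = pairing w v"
  unfolding pairing_def by (intro sum.cong refl) simp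

lemma metric_comp_XX: "metric_comp f P Xc Xc = - 2 * potential f P"
  by (simp add: potential_def zpart_def)

lemma M_metric_nth: "M_metric f P $ i $ j = metric_comp f P i j"
  by (simp add: M_metric_def)

lemma M_metric_mult_nth:
  "(M_metric f P *v w) $ Xc = w $ Xs - 2 * potential f P * w $ Xc"
  "(M_metric f P *v w) $ Xs = w $ Xc"
  "(M_metric f P *v w) $ Zc i = w $ Zs i"
  "(M_metric f P *v w) $ Zs i = w $ Zc i"
  "(M_metric f P *v w) $ Ztc i = w $ Zts i"
  "(M_metric f P *v w) $ Zts i = w $ Ztc i"
  by (simp_all add: matrix_vector_mult_def M_metric_nth sum_coord metric_comp_XX if_distrib
      if_distribR sum.delta cong: if_cong del: metric_comp.simps(1))

lemma bform_M_metric: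
  "bform (M_metric f P) v w = - 2 * potential f P * v $ Xc * w $ Xc + v $ Xc * w $ Xs + v $ Xs * w $ Xc
    + (\<Sum>i\<in>UNIV. v $ Zc i * w $ Zs i + v $ Zs i * w $ Zc i + v $ Ztc i * w $ Zts i + v $ Zts i * w $ Ztc i)"
  by (simp add: bform_def inner_vec_def sum_coord M_metric_mult_nth sum.distrib algebra_simps)

lemma bform_M_metric_commute: "bform (M_metric f P) v w = bform (M_metric f P) w v"
  unfolding bform_M_metric by (simp add: algebra_simps)

lemma M_metric_mult_eq_0: "M_metric f P *v w = 0 \<longleftrightarrow> w = 0"
proof
  assume 0: "M_metric f P *v w = 0"
  then have *: "(M_metric f P *v w) $ k = 0" for k by simp
  \<comment> \<open>Row \<open>Xs\<close> comes first: it kills \<open>w $ Xc\<close>, and with it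
    the potential term in row \<open>Xc\<close>.\<close>
  have x: "w $ Xc = 0" using *[of Xs] by (simp only: M_metric_mult_nth)
  have "w $ k = 0" for k
    by (cases k) (use x *[of Xc] *[of "Zc _"] *[of "Zs _"] *[of "Ztc _"] *[of "Zts _"] in
        \<open>simp_all add: M_metric_mult_nth\<close>)
  then show "w = 0" by (simp add: vec_eq_iff)
qed simp

lemma invertible_M_metric: "invertible (M_metric f P)"
  unfolding invertible_left_inverse matrix_left_invertible_ker
  by (simp add: M_metric_mult_eq_0)

text \<open>Turns a computation with the inverse metric into a check with the metric itself: a
  candidate is guessed and its index lowered.\<close>

lemma matrix_inv_M_metric_mult:
  assumes "M_metric f P *v u = w"
  shows "matrix_inv (M_metric f P) *v w = u"
proof -
  have "matrix_inv (M_metric f P) ** M_metric f P = mat 1"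
    using invertible_M_metric[of f P] unfolding matrix_inv_def invertible_def
    by (metis (mono_tags, lifting) someI_ex)
  then show ?thesis
    using assms by (metis matrix_vector_mul_assoc matrix_vector_mul_lid)
qed

section \<open>Derivatives of the potential and the Christoffel symbols\<close>

lemma bounded_linear_zpart: "bounded_linear (zpart :: real ^ 'n::finite coord \<Rightarrow> _)"
  by (rule linear_conv_bounded_linear[THEN iffD1], rule linearI) (auto simp: zpart_def vec_eq_iff)

lemma zpart_axis:
  "zpart (axis (Zc i) 1) = axis i 1" "zpart (axis Xc 1) = 0" "zpart (axis Xs 1) = 0"
  "zpart (axis (Ztc i) 1) = 0" "zpart (axis (Zs i) 1) = 0" "zpart (axis (Zts i) 1) = 0"
  by (auto simp: zpart_def vec_eq_iff axis_def)

lemma pairing_axis: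
  "pairing P (axis (Zc i) 1) = P $ Ztc i" "pairing P (axis (Ztc i) 1) = P $ Zc i"
  "pairing P (axis Xc 1) = 0" "pairing P (axis Xs 1) = 0"
  "pairing P (axis (Zs i) 1) = 0" "pairing P (axis (Zts i) 1) = 0"
  by (simp_all add: pairing_def axis_def sum.distrib if_distrib[of "\<lambda>x. _ * x"] cong: if_cong)

lemma has_derivative_zpart: "(zpart has_derivative zpart) (at P)"
  by (rule bounded_linear_imp_has_derivative[OF bounded_linear_zpart])

lemma has_derivative_comp_zpart:
  "f differentiable (at (zpart P)) \<Longrightarrow>
    ((\<lambda>P. f (zpart P)) has_derivative (\<lambda>v. dird f (zpart P) (zpart v))) (at P)"
  by (rule has_derivative_compose[OF has_derivative_zpart]) (rule has_derivative_dird)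

lemma Ck_comp_zpart: "Ck k f \<Longrightarrow> Ck k (\<lambda>P. f (zpart P))"
proof (induction k arbitrary: f)
  case 0
  then show ?case
    by (simp add: continuous_on_compose2[OF _ linear_continuous_on[OF bounded_linear_zpart]])
next
  case (Suc k)
  have D: "dird (\<lambda>P. f (zpart P)) P v = dird f (zpart P) (zpart v)" for P v
    using Suc.prems by (subst dird_eq[OF has_derivative_comp_zpart]) auto
  \<comment> \<open>A partial derivative of the composite is a partial derivative of
    \<open>f\<close> after \<open>zpart\<close> in a z-direction, and zero in all others.\<close>
  have "Ck k (\<lambda>P. dird f (zpart P) (zpart (axis i 1)))" for i
  proof (cases "\<exists>j. i = Zc j")
    case True
    then obtain j where "i = Zc j" ..
    moreover have "Ck k (\<lambda>P. dird f (zpart P) (axis j 1))"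
      using Suc.prems by (intro Suc.IH[of "\<lambda>Q. dird f Q (axis j 1)"]) simp
    ultimately show ?thesis by (simp add: zpart_axis)
  next
    case False
    then have "zpart (axis i 1) = 0" by (cases i) (auto simp: zpart_axis)
    moreover have "dird f Q 0 = 0" for Q
      using Suc.prems by (intro linear_0 linear_dird) simp
    ultimately show ?thesis by (simp add: Ck_const)
  qed
  moreover have "(\<lambda>P. f (zpart P)) differentiable (at P)" for P
    using Suc.prems has_derivative_comp_zpart[of f P] by (auto simp: differentiable_def)
  ultimately show ?case by (simp add: D)
qed

lemma smooth_potential: "smooth f \<Longrightarrow> smooth (potential f)"
  unfolding potential_def[abs_def]
  by (intro smooth_intros) (auto simp: smooth_def intro: Ck_comp_zpart)

lemma dird_potential:
  assumes "smooth f"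
  shows "dird (potential f) P v = dird f (zpart P) (zpart v) + pairing P v"
proof -
  note nth = bounded_linear_imp_has_derivative[OF bounded_linear_vec_nth]
  have "(potential f has_derivative (\<lambda>v. dird f (zpart P) (zpart v)
      + (\<Sum>i\<in>UNIV. P $ Zc i * v $ Ztc i + v $ Zc i * P $ Ztc i))) (at P)"
    unfolding potential_def[abs_def]
    by (intro has_derivative_add has_derivative_sum has_derivative_mult nth
        has_derivative_comp_zpart smooth_differentiable assms)
  then show ?thesis
    by (simp add: dird_eq pairing_def mult.commute)
qed

lemma smooth_metric_comp:
  assumes "smooth f"
  shows "smooth (\<lambda>P. metric_comp f P i j)"
proof (cases "i = Xc \<and> j = Xc")
  case True
  then show ?thesis
    unfolding True[THEN conjunct1] True[THEN conjunct2] metric_comp_XX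
    by (intro smooth_intros smooth_potential assms)
next
  case False
  then show ?thesis by (cases i; cases j) (simp_all add: smooth_const)
qed

lemma pseudo_riemannian_M_metric:
  assumes "smooth f"
  shows "pseudo_riemannian (M_metric f)"
proof -
  have "metric_comp f P i j = metric_comp f P j i" for P i j
    by (cases i; cases j) auto
  then show ?thesis
    by (auto simp: pseudo_riemannian_def M_metric_nth invertible_M_metric transpose_def vec_eq_iff
        smooth_metric_comp[OF assms])
qed

lemma dird_metric_comp:
  assumes "smooth f"
  shows "dird (\<lambda>Q. metric_comp f Q i j) P v
    = - 2 * (if i = Xc \<and> j = Xc then dird (potential f) P v else 0)"
proof (cases "i = Xc \<and> j = Xc")
  case True
  have "dird (\<lambda>Q. - 2 * potential f Q) P v = - 2 * dird (potential f) P v"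
    by (subst dird_eq[OF has_derivative_mult_right[OF has_derivative_dird]])
      (auto intro: smooth_differentiable smooth_potential assms)
  with True show ?thesis by (auto simp: metric_comp_XX simp del: metric_comp.simps(1))
next
  case False
  then show ?thesis by (cases i; cases j) simp_all
qed

lemma dird_potential_axis:
  assumes "smooth f"
  shows "dird (potential f) P (axis Xc 1) = 0"
    "dird (potential f) P (axis Xs 1) = 0"
    "dird (potential f) P (axis (Zs i) 1) = 0"
    "dird (potential f) P (axis (Zts i) 1) = 0"
    "dird (potential f) P (axis (Zc i) 1) = dird f (zpart P) (axis i 1) + P $ Ztc i"
    "dird (potential f) P (axis (Ztc i) 1) = P $ Zc i"
proof -
  have 0: "dird f Q 0 = 0" for Q
    using linear_0[OF linear_dird[OF smooth_differentiable[OF assms]]] .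
  show "dird (potential f) P (axis Xc 1) = 0"
    "dird (potential f) P (axis Xs 1) = 0"
    "dird (potential f) P (axis (Zs i) 1) = 0"
    "dird (potential f) P (axis (Zts i) 1) = 0"
    "dird (potential f) P (axis (Zc i) 1) = dird f (zpart P) (axis i 1) + P $ Ztc i"
    "dird (potential f) P (axis (Ztc i) 1) = P $ Zc i"
    by (simp_all add: dird_potential[OF assms] zpart_axis 0 pairing_axis)
qed

text \<open>Only \<open>g(\<partial>\<^sub>x,\<partial>\<^sub>x)\<close> varies, so a symbol of the
  first kind needs two indices \<open>Xc\<close>. Raising the last index swaps coordinates with
  their duals; since the potential has no x-derivative, the result lies in the dual
  directions.\<close>

lemma christoffel_M_metric:
  fixes f :: "real ^ 'n::finite \<Rightarrow> real"
  assumes "smooth f"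
  defines "D \<equiv> dird (potential f)"
  shows "christoffel (M_metric f) P v w = (\<chi> k. case k of
      Xs \<Rightarrow> - (D P v * w $ Xc + D P w * v $ Xc)
    | Zs i \<Rightarrow> v $ Xc * w $ Xc * D P (axis (Zc i) 1)
    | Zts i \<Rightarrow> v $ Xc * w $ Xc * D P (axis (Ztc i) 1)
    | _ \<Rightarrow> 0)" (is "_ = ?u")
  unfolding christoffel_def
proof (rule matrix_inv_M_metric_mult)
  have Dv: "D P v = (\<Sum>i\<in>UNIV. v $ Zc i * D P (axis (Zc i) 1)) + (\<Sum>i\<in>UNIV. v $ Ztc i * D P (axis (Ztc i) 1))" for v
    unfolding D_def
    by (subst dird_axis_expansion)
      (simp_all add: smooth_differentiable smooth_potential assms sum_coord dird_potential_axis)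
  have c: "christoffel1 (M_metric f) P i j k =
     - (if j = Xc \<and> k = Xc then D P (axis i 1) else 0) - (if i = Xc \<and> k = Xc then D P (axis j 1) else 0)
     + (if i = Xc \<and> j = Xc then D P (axis k 1) else 0)" for i j k
    unfolding christoffel1_def M_metric_nth dird_metric_comp[OF assms(1)] D_def
    by (simp add: field_simps split del: if_split)
  have D0: "D P (axis Xc 1) = 0" "D P (axis Xs 1) = 0" "D P (axis (Zs i) 1) = 0" "D P (axis (Zts i) 1) = 0" for i
    by (simp_all add: D_def dird_potential_axis assms)
  have "(M_metric f P *v ?u) $ k
      = (\<Sum>i\<in>UNIV. \<Sum>j\<in>UNIV. christoffel1 (M_metric f) P i j k * v $ i * w $ j)" for k
    by (cases k) (simp_all add: M_metric_mult_nth c sum_coord D0 Dv[of v] Dv[of w] sum_distrib_left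
        sum_distrib_right sum.distrib sum_negf algebra_simps)
  then show "M_metric f P *v ?u
      = (\<chi> k. \<Sum>i\<in>UNIV. \<Sum>j\<in>UNIV. christoffel1 (M_metric f) P i j k * v $ i * w $ j)"
    by (simp add: vec_eq_iff)
qed


section \<open>Curvature and 0-models\<close>

lemma has_derivative_dird_hess:
  "smooth F \<Longrightarrow> ((\<lambda>Q. dird F Q v) has_derivative (\<lambda>u. hess F P u v)) (at P)"
  unfolding hess_def by (intro has_derivative_dird smooth_differentiable smooth_dird)

lemma hess_potential:
  assumes "smooth f"
  shows "hess (potential f) P u v = hess f (zpart P) (zpart u) (zpart v) + pairing u v"
proof -
  note nth = bounded_linear_imp_has_derivative[OF bounded_linear_vec_nth]
  have "((\<lambda>Q. dird f (zpart Q) (zpart v)) has_derivative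
      (\<lambda>u. hess f (zpart P) (zpart u) (zpart v))) (at P)"
    unfolding hess_def
    by (intro has_derivative_comp_zpart smooth_differentiable smooth_dird assms)
  moreover have "((\<lambda>Q. pairing Q v) has_derivative (\<lambda>u. pairing u v)) (at P)"
    unfolding pairing_def
    by (intro has_derivative_sum has_derivative_add has_derivative_mult_left nth)
  ultimately show ?thesis
    unfolding hess_def[of "potential f"] dird_potential[OF assms]
    by (simp add: dird_eq[OF has_derivative_add])
qed

text \<open>Pairing the derivative of the Christoffel vector with a vector produces exactly this sum
  over coordinate axes; the lemma reassembles it into one Hessian value.\<close>

lemma hess_potential_components:
  assumes "smooth f"
  shows "hess (potential f) P u v =
    (\<Sum>i\<in>UNIV. v $ Zc i * hess (potential f) P u (axis (Zc i) 1)
       + v $ Ztc i * hess (potential f) P u (axis (Ztc i) 1))"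
proof -
  have 0: "hess f Q 0 w = 0" for Q w
    by (rule linear_0[OF linear_hess[OF assms]])
  have "hess (potential f) P (axis Xc 1) u = 0" "hess (potential f) P (axis Xs 1) u = 0"
    "hess (potential f) P (axis (Zs i) 1) u = 0" "hess (potential f) P (axis (Zts i) 1) u = 0" for i
    by (simp_all add: hess_potential assms zpart_axis pairing_axis 0 pairing_commute[of _ u])
  then show ?thesis
    unfolding hess_sym[OF smooth_potential[OF assms], of P u]
    by (subst hess_axis_expansion[OF smooth_potential[OF assms]]) (simp add: sum_coord sum.distrib)
qed

lemma dird_christoffel_M_metric:
  fixes f :: "real ^ 'n::finite \<Rightarrow> real"
  assumes "smooth f"
  defines "H \<equiv> hess (potential f)"
  shows "dird (\<lambda>Q. christoffel (M_metric f) Q v w) P u = (\<chi> k. case k of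
      Xs \<Rightarrow> - (H P u v * w $ Xc + H P u w * v $ Xc)
    | Zs i \<Rightarrow> v $ Xc * w $ Xc * H P u (axis (Zc i) 1)
    | Zts i \<Rightarrow> v $ Xc * w $ Xc * H P u (axis (Ztc i) 1)
    | _ \<Rightarrow> 0)" (is "_ = ?D u")
proof -
  note D = has_derivative_dird_hess[OF smooth_potential[OF assms(1)], folded H_def]
  have "((\<lambda>Q. christoffel (M_metric f) Q v w) has_derivative ?D) (at P)"
  proof (rule has_derivative_vec)
    fix k
    show "((\<lambda>Q. christoffel (M_metric f) Q v w $ k) has_derivative (\<lambda>u. ?D u $ k)) (at P)"
      by (cases k) (simp_all only: christoffel_M_metric[OF assms(1)] vec_lambda_beta coord.case,
          (intro D has_derivative_const has_derivative_minus has_derivative_add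
            has_derivative_mult_left has_derivative_mult_right)+)
  qed
  then show ?thesis by (simp only: dird_eq)
qed

lemma curv_tensor_M_metric:
  fixes f :: "real ^ 'n::finite \<Rightarrow> real"
  assumes "smooth f"
  defines "H \<equiv> hess (potential f)"
  shows "curv_tensor (M_metric f) P vs =
      vs ! 2 $ Xc * (vs ! 1 $ Xc * H P (vs ! 0) (vs ! 3) - vs ! 0 $ Xc * H P (vs ! 1) (vs ! 3))
    - vs ! 3 $ Xc * (vs ! 1 $ Xc * H P (vs ! 0) (vs ! 2) - vs ! 0 $ Xc * H P (vs ! 1) (vs ! 2))"
proof -
  let ?g = "M_metric f"
  let ?G = "christoffel ?g"
  define a b c d where abcd: "a = vs ! 0" "b = vs ! 1" "c = vs ! 2" "d = vs ! 3"
  \<comment> \<open>The quadratic Christoffel term vanishes: the inner value has zero x, z and z~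
    components, and these are all that the outer symbol sees.\<close>
  have nn: "nabla ?g (\<lambda>_. u) (nabla ?g (\<lambda>_. v) (\<lambda>_. w)) P = dird (\<lambda>Q. ?G Q v w) P u" for u v w
  proof -
    have D0: "dird (potential f) P (?G P v w) = 0"
      using linear_0[OF linear_dird[OF smooth_differentiable[OF assms(1)]]]
      by (simp add: dird_potential christoffel_M_metric assms(1) zpart_def pairing_def
          flip: zero_vec_def)
    have "nabla ?g (\<lambda>_. u) (nabla ?g (\<lambda>_. v) (\<lambda>_. w)) P
        = dird (\<lambda>Q. ?G Q v w) P u + ?G P u (?G P v w)"
      by (simp add: nabla_def)
    also have "?G P u (?G P v w) = 0"
      unfolding christoffel_M_metric[OF assms(1), of P u] D0
      by (auto simp: vec_eq_iff christoffel_M_metric[OF assms(1)] split: coord.split)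
    finally show ?thesis by simp
  qed
  have "bracket (\<lambda>_. a) (\<lambda>_. b) = (\<lambda>_. 0)"
    by (simp add: bracket_def fun_eq_iff)
  moreover have "nabla ?g (\<lambda>_. 0) (\<lambda>_. c) P = 0"
    by (simp add: nabla_def christoffel_def flip: zero_vec_def)
  ultimately have "curv_tensor ?g P vs
      = bform (?g P) (dird (\<lambda>Q. ?G Q b c) P a - dird (\<lambda>Q. ?G Q a c) P b) d"
    by (simp only: curv_tensor_def curv_def nn diff_0_right flip: abcd)
  also have "\<dots> = c $ Xc * (b $ Xc * H P a d - a $ Xc * H P b d)
    - d $ Xc * (b $ Xc * H P a c - a $ Xc * H P b c)"
  proof -
    \<comment> \<open>The \<open>Xs\<close> components contain \<open>H P a b\<close> and
      \<open>H P b a\<close> with opposite signs; symmetry cancels them.\<close>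
    have sym: "H P a b = H P b a"
      unfolding H_def by (intro hess_sym smooth_potential assms)
    show ?thesis
      unfolding H_def hess_potential_components[OF assms(1), of P _ d]
      by (simp add: bform_M_metric dird_christoffel_M_metric[OF assms(1)] sum.distrib
          sum_subtractf sum_distrib_left algebra_simps sym[unfolded H_def])
  qed
  finally show ?thesis by (simp add: abcd)
qed

section \<open>The isomorphism of 0-models\<close>

lemma bform_M_metric_nondegenerate:
  assumes "\<And>w. bform (M_metric f P) w v = 0"
  shows "v = 0"
proof -
  have "(M_metric f P *v v) \<bullet> (M_metric f P *v v) = 0"
    using assms unfolding bform_def by blast
  then show ?thesis by (simp add: M_metric_mult_eq_0)
qed

lemma model_iso_0_M_metric:
  fixes f :: "real ^ 'n::finite \<Rightarrow> real" and P Q :: "real ^ 'n coord"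
  assumes "smooth f"
  shows "\<exists>L. model_iso 0 (M_metric f) P S_metric Q L"
proof -
  define K where "K = hess f (zpart P)"
  \<comment> \<open>Half of \<open>K\<close> suffices in \<open>Ztc\<close> because the pairing
    counts it twice. The \<open>Zs\<close> entry is minus the transpose of this shear, restoring the
    metric, and the \<open>Xs\<close> entry corrects the value of
    \<open>g(\<partial>\<^sub>x,\<partial>\<^sub>x)\<close>.\<close>
  define L :: "real ^ 'n coord \<Rightarrow> real ^ 'n coord" where "L v = (\<chi> k. case k of
      Xc \<Rightarrow> v $ Xc | Zc i \<Rightarrow> v $ Zc i | Zts i \<Rightarrow> v $ Zts i
    | Ztc i \<Rightarrow> v $ Ztc i + K (zpart v) (axis i 1) / 2
    | Xs \<Rightarrow> v $ Xs + (potential (\<lambda>_. 0) Q - potential f P) * v $ Xc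
    | Zs i \<Rightarrow> v $ Zs i - (\<Sum>j\<in>UNIV. v $ Zts j * K (axis i 1) (axis j 1)) / 2)" for v
  have L_nth: "L v $ Xc = v $ Xc" "L v $ Zc i = v $ Zc i" "L v $ Zts i = v $ Zts i"
      "L v $ Ztc i = v $ Ztc i + K (zpart v) (axis i 1) / 2"
      "L v $ Xs = v $ Xs + (potential (\<lambda>_. 0) Q - potential f P) * v $ Xc"
      "L v $ Zs i = v $ Zs i - (\<Sum>j\<in>UNIV. v $ Zts j * K (axis i 1) (axis j 1)) / 2" for v i
    by (simp_all add: L_def)
  have K_lin: "linear (\<lambda>u. K u v)" for v
    unfolding K_def by (rule linear_hess[OF assms])
  have zpart_lin: "zpart (u + v) = zpart u + zpart v" "zpart (c *\<^sub>R v) = c *\<^sub>R zpart v"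
    for u v :: "real ^ 'n coord" and c
    by (simp_all add: zpart_def vec_eq_iff)
  have K_sum: "K (zpart u) v = (\<Sum>i\<in>UNIV. u $ Zc i * K (axis i 1) v)" for u v
    unfolding K_def by (subst hess_axis_expansion[OF assms]) (simp add: zpart_def)
  have "linear L"
  proof (rule linearI)
    show "L (u + v) = L u + L v" for u v
      unfolding vec_eq_iff
    proof
      show "L (u + v) $ k = (L u + L v) $ k" for k
        by (cases k) (simp_all add: L_nth zpart_lin linear_add[OF K_lin] distrib_left distrib_right
            add_divide_distrib sum.distrib)
    qed
    show "L (c *\<^sub>R v) = c *\<^sub>R L v" for c v
      unfolding vec_eq_iff
    proof
      show "L (c *\<^sub>R v) $ k = (c *\<^sub>R L v) $ k" for k
        by (cases k) (simp_all add: L_nth zpart_lin linear_scale[OF K_lin] right_diff_distrib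
            distrib_left sum_distrib_left mult.assoc mult.left_commute)
    qed
  qed
  have metric: "bform (S_metric Q) (L v) (L w) = bform (M_metric f P) v w" for v w
  proof -
    \<comment> \<open>The cross terms from \<open>Zc\<close>, \<open>Zs\<close> and from
      \<open>Ztc\<close>, \<open>Zts\<close> become equal after exchanging the sums, and they occur
      with opposite signs.\<close>
    have swap: "(\<Sum>i\<in>UNIV. u $ Zc i * (\<Sum>j\<in>UNIV. s $ Zts j * K (axis i 1) (axis j 1)))
        = (\<Sum>j\<in>UNIV. K (zpart u) (axis j 1) * s $ Zts j)" for u s
      unfolding K_sum sum_distrib_left sum_distrib_right
      by (subst sum.swap) (intro sum.cong refl, simp add: mult_ac)
    have *: "(\<Sum>i\<in>UNIV. L v $ Zc i * L w $ Zs i + L v $ Zs i * L w $ Zc i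
          + L v $ Ztc i * L w $ Zts i + L v $ Zts i * L w $ Ztc i)
      = (\<Sum>i\<in>UNIV. v $ Zc i * w $ Zs i + v $ Zs i * w $ Zc i + v $ Ztc i * w $ Zts i + v $ Zts i * w $ Ztc i)
        - (\<Sum>i\<in>UNIV. v $ Zc i * (\<Sum>j\<in>UNIV. w $ Zts j * K (axis i 1) (axis j 1))) / 2
        - (\<Sum>i\<in>UNIV. w $ Zc i * (\<Sum>j\<in>UNIV. v $ Zts j * K (axis i 1) (axis j 1))) / 2
        + (\<Sum>j\<in>UNIV. K (zpart v) (axis j 1) * w $ Zts j) / 2
        + (\<Sum>j\<in>UNIV. K (zpart w) (axis j 1) * v $ Zts j) / 2"
      unfolding sum_divide_distrib sum.distrib[symmetric] sum_subtractf[symmetric]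
      unfolding L_nth by (intro sum.cong refl) (simp add: field_simps)
    show ?thesis
      unfolding S_metric_def bform_M_metric *
      unfolding swap L_nth by (simp add: algebra_simps)
  qed
  have hess: "hess (potential (\<lambda>_. 0)) Q (L u) (L v) = hess (potential f) P u v" for u v
  proof -
    have "pairing (L u) (L v) = pairing u v
        + (\<Sum>i\<in>UNIV. u $ Zc i * K (axis i 1) (zpart v)) / 2 + (\<Sum>i\<in>UNIV. v $ Zc i * K (axis i 1) (zpart u)) / 2"
      unfolding pairing_def sum_divide_distrib sum.distrib[symmetric] L_nth
      by (intro sum.cong refl) (simp add: field_simps K_def hess_sym[OF assms, of _ "axis _ 1"])
    also have "\<dots> = pairing u v + K (zpart u) (zpart v)"
      unfolding K_sum[symmetric] by (simp add: K_def hess_sym[OF assms, of _ "zpart v"])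
    finally show ?thesis
      by (simp add: hess_potential smooth_const assms K_def hess_def[of "\<lambda>_. 0"])
  qed
  \<comment> \<open>A map that carries one form to another has its kernel in the radical of the
    first, which is zero here.\<close>
  have "inj L"
    unfolding linear_injective_0[OF \<open>linear L\<close>]
  proof (intro allI impI)
    fix v assume "L v = 0"
    then have "bform (M_metric f P) w v = 0" for w
      using metric[of w v] by (simp add: bform_def)
    then show "v = 0" by (rule bform_M_metric_nondegenerate)
  qed
  then have "bij L"
    using linear_injective_imp_surjective[OF \<open>linear L\<close>] by (simp add: bij_def)
  moreover have "curv_tensor S_metric Q (map L vs) = curv_tensor (M_metric f) P vs"
    if "length vs = 4" for vs
    using that unfolding S_metric_def
    by (simp add: curv_tensor_M_metric assms smooth_const hess L_nth)
  ultimately have "model_iso 0 (M_metric f) P S_metric Q L"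
    unfolding model_iso_def using \<open>linear L\<close> metric by (auto simp: nabla_curv_def)
  then show ?thesis by blast
qed


section \<open>Isometries\<close>

abbreviation pot0 :: "real ^ 'n::finite coord \<Rightarrow> real"
  where "pot0 \<equiv> potential (\<lambda>_. 0)"

lemma pot0_eq_pairing: "pot0 v = pairing v v / 2"
  by (simp add: potential_def pairing_def sum_distrib_left mult.commute)

text \<open>With \<open>y = (z, z~)\<close>, \<open>B\<close> the pairing and \<open>\<phi>(y) = B(y,y)/2\<close>, replacing \<open>y\<close> by \<open>e y + a\<close> (\<open>e = \<plusminus>1\<close>)
  changes \<open>g(\<partial>\<^sub>x,\<partial>\<^sub>x)\<close> by \<open>- 2 (e B(y,a) + \<phi>(a))\<close>. The terms added to the dual coordinates absorb this:
  the \<open>dx dy\<close> contributions of \<open>(x - m) B(y,a)\<close> and of \<open>- (x - m)\<^sup>2/2\<close> cancel. The centre \<open>m\<close> is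
  free; taking the \<open>x\<close>-coordinate of a fixed point for it makes the differential there \<open>- id\<close> when \<open>e = - 1\<close>.\<close>

definition motion :: "real \<Rightarrow> real \<Rightarrow> real ^ 'n::finite coord \<Rightarrow> real ^ 'n coord \<Rightarrow> real ^ 'n coord"
  where "motion e m a P = (\<chi> k. case k of
      Xs \<Rightarrow> e * P $ Xs + a $ Xs + e * pot0 a * P $ Xc + (P $ Xc - m) * pairing P a
    | Zs i \<Rightarrow> e * P $ Zs i + a $ Zs i - (P $ Xc - m) * (P $ Xc - m) * (a $ Ztc i / 2)
    | Zts i \<Rightarrow> e * P $ Zts i + a $ Zts i - (P $ Xc - m) * (P $ Xc - m) * (a $ Zc i / 2)
    | _ \<Rightarrow> e * P $ k + a $ k)"

definition motion_deriv ::
  "real \<Rightarrow> real \<Rightarrow> real ^ 'n::finite coord \<Rightarrow> real ^ 'n coord \<Rightarrow> real ^ 'n coord \<Rightarrow> real ^ 'n coord"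
  where "motion_deriv e m a P v = (\<chi> k. case k of
      Xs \<Rightarrow> e * v $ Xs + e * pot0 a * v $ Xc + (P $ Xc - m) * pairing v a + v $ Xc * pairing P a
    | Zs i \<Rightarrow> e * v $ Zs i - (P $ Xc - m) * v $ Xc * a $ Ztc i
    | Zts i \<Rightarrow> e * v $ Zts i - (P $ Xc - m) * v $ Xc * a $ Zc i
    | _ \<Rightarrow> e * v $ k)"

lemma motion_nth:
  "motion e m a P $ Xc = e * P $ Xc + a $ Xc"
  "motion e m a P $ Zc i = e * P $ Zc i + a $ Zc i"
  "motion e m a P $ Ztc i = e * P $ Ztc i + a $ Ztc i"
  "motion e m a P $ Xs = e * P $ Xs + a $ Xs + e * pot0 a * P $ Xc + (P $ Xc - m) * pairing P a"
  "motion e m a P $ Zs i = e * P $ Zs i + a $ Zs i - (P $ Xc - m) * (P $ Xc - m) * (a $ Ztc i / 2)"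
  "motion e m a P $ Zts i = e * P $ Zts i + a $ Zts i - (P $ Xc - m) * (P $ Xc - m) * (a $ Zc i / 2)"
  by (simp_all add: motion_def)

lemma motion_deriv_nth:
  "motion_deriv e m a P v $ Xc = e * v $ Xc"
  "motion_deriv e m a P v $ Zc i = e * v $ Zc i"
  "motion_deriv e m a P v $ Ztc i = e * v $ Ztc i"
  "motion_deriv e m a P v $ Xs = e * v $ Xs + e * pot0 a * v $ Xc + (P $ Xc - m) * pairing v a + v $ Xc * pairing P a"
  "motion_deriv e m a P v $ Zs i = e * v $ Zs i - (P $ Xc - m) * v $ Xc * a $ Ztc i"
  "motion_deriv e m a P v $ Zts i = e * v $ Zts i - (P $ Xc - m) * v $ Xc * a $ Zc i"
  by (simp_all add: motion_deriv_def)

lemma smooth_map_motion: "smooth_map (motion e m a)"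
  unfolding smooth_map_def
proof
  show "smooth (\<lambda>P. motion e m a P $ k)" for k
    by (cases k) (auto simp: motion_nth pairing_def intro!: smooth_intros)
qed

lemma has_derivative_motion: "(motion e m a has_derivative motion_deriv e m a P) (at P)"
proof (rule has_derivative_vec)
  note nth = bounded_linear_imp_has_derivative[OF bounded_linear_vec_nth]
  have pair: "((\<lambda>Q. pairing Q a) has_derivative (\<lambda>v. pairing v a)) (at P)"
    unfolding pairing_def
    by (intro has_derivative_sum has_derivative_add has_derivative_mult_left nth)
  show "((\<lambda>Q. motion e m a Q $ k) has_derivative (\<lambda>v. motion_deriv e m a P v $ k)) (at P)" for k
    by (cases k; simp only: motion_nth motion_deriv_nth; (rule has_derivative_eq_rhs,
        (rule has_derivative_const has_derivative_add has_derivative_diff has_derivative_mult nth pair)+,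
        simp add: fun_eq_iff field_simps))
qed

lemma pairing_motion: "pairing (motion e m a P) v = e * pairing P v + pairing a v"
  by (simp add: pairing_def motion_nth sum_distrib_left sum.distrib algebra_simps)

lemma pot0_motion:
  assumes "e * e = 1"
  shows "pot0 (motion e m a P) = pot0 P + e * pairing P a + pot0 a"
proof -
  have e: "e * (e * x) = x" for x
    using assms by (simp flip: mult.assoc)
  have "pairing (motion e m a P) (motion e m a P)
      = e * (e * pairing P P) + 2 * e * pairing P a + pairing a a"
    unfolding pairing_motion pairing_commute[of P "motion e m a P"] pairing_commute[of a "motion e m a P"]
    unfolding pairing_motion pairing_commute[of a P] by (simp add: algebra_simps)
  then show ?thesis by (simp add: pot0_eq_pairing e add_divide_distrib)
qed

lemma bform_motion:
  assumes "e * e = 1"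
  shows "bform (S_metric (motion e m a P)) (motion_deriv e m a P v) (motion_deriv e m a P w)
    = bform (S_metric P) v w"
proof -
  have e: "e * (e * x) = x" for x
    using assms by (simp flip: mult.assoc)
  let ?v = "motion_deriv e m a P v" and ?w = "motion_deriv e m a P w"
  \<comment> \<open>The mixed term left over by the dual blocks is cancelled by the summand with
    \<open>P $ Xc - m\<close> in the \<open>Xs\<close> component.\<close>
  have "(\<Sum>i\<in>UNIV. ?v $ Zc i * ?w $ Zs i + ?v $ Zs i * ?w $ Zc i + ?v $ Ztc i * ?w $ Zts i + ?v $ Zts i * ?w $ Ztc i)
     = (\<Sum>i\<in>UNIV. v $ Zc i * w $ Zs i + v $ Zs i * w $ Zc i + v $ Ztc i * w $ Zts i + v $ Zts i * w $ Ztc i)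
       - e * (P $ Xc - m) * (w $ Xc * pairing v a + v $ Xc * pairing w a)"
    unfolding pairing_def sum_distrib_left sum.distrib[symmetric] sum_subtractf[symmetric]
    by (intro sum.cong refl) (simp add: motion_deriv_nth algebra_simps e)
  then show ?thesis
    unfolding S_metric_def bform_M_metric
    by (simp add: motion_deriv_nth pot0_motion[OF assms] algebra_simps e)
qed

lemma motion_inverse:
  fixes a :: "real ^ 'n::finite coord"
  assumes "e * e = 1"
  obtains m' and a' :: "real ^ 'n coord"
    where "\<And>P. motion e m' a' (motion e m a P) = P" "\<And>P. motion e m a (motion e m' a' P) = P"
proof
  \<comment> \<open>The inverse is again a motion. Its centre is the image of \<open>m\<close> under
    the x-part, so the image of \<open>P\<close> has offset \<open>e * (P $ Xc - m)\<close>. The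
    extra \<open>Xs\<close> entry of \<open>a'\<close> absorbs the constants left in that
    coordinate.\<close>
  define m' where "m' = a $ Xc + e * m"
  define a' :: "real ^ 'n coord" where "a' = (\<chi> k. - e * a $ k
    + (if k = Xs then e * pot0 a * a $ Xc - 2 * e * pot0 a * m' else 0))"
  have e: "e * (e * x) = x" for x
    using assms by (simp flip: mult.assoc)
  have a': "a' $ Xs = - e * a $ Xs + e * pot0 a * a $ Xc - 2 * e * pot0 a * m'"
    "k \<noteq> Xs \<Longrightarrow> a' $ k = - e * a $ k" for k
    by (simp_all add: a'_def)
  have p: "pairing v a' = - e * pairing v a" for v
    by (simp add: pairing_def a' sum_distrib_left algebra_simps flip: sum_negf)
  have q: "pot0 a' = pot0 a"
    by (simp add: pot0_eq_pairing p pairing_commute[of a'] e)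
  have r: "pairing a a = 2 * pot0 a" by (simp add: pot0_eq_pairing)
  show "motion e m' a' (motion e m a P) = P" for P
    unfolding vec_eq_iff
  proof
    show "motion e m' a' (motion e m a P) $ k = P $ k" for k
      by (cases k) (simp_all add: motion_nth a' p q r pairing_motion m'_def algebra_simps e)
  qed
  show "motion e m a (motion e m' a' P) = P" for P
    unfolding vec_eq_iff
  proof
    show "motion e m a (motion e m' a' P) $ k = P $ k" for k
      by (cases k) (simp_all add: motion_nth a' p q r pairing_motion pairing_commute[of a' a]
          m'_def algebra_simps e)
  qed
qed

lemma isometry_motion:
  assumes "e * e = 1"
  shows "isometry S_metric S_metric (motion e m a)"
proof -
  obtain m' a' where inv: "\<And>P. motion e m' a' (motion e m a P) = P"
    "\<And>P. motion e m a (motion e m' a' P) = P"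
    using motion_inverse[OF assms] by metis
  then have "inv (motion e m a) = motion e m' a'"
    by (intro inv_equality)
  moreover have "bij (motion e m a)"
    using inv by (intro bijI') metis+
  ultimately show ?thesis
    unfolding isometry_def
    by (simp add: smooth_map_motion dird_eq[OF has_derivative_motion] bform_motion[OF assms])
qed

text \<open>The x, z and z~ entries of \<open>a\<close> are forced. The dual entries enter
  additively and affect neither \<open>pairing\<close> nor \<open>pot0\<close>, so they can be
  solved for afterwards. The stated entries serve to identify the differential of the geodesic
  symmetry.\<close>

lemma motion_transitive:
  fixes P Q :: "real ^ 'n::finite coord"
  shows "\<exists>a. motion e m a P = Q \<and> a $ Xc = Q $ Xc - e * P $ Xc \<and>
    (\<forall>i. a $ Zc i = Q $ Zc i - e * P $ Zc i) \<and> (\<forall>i. a $ Ztc i = Q $ Ztc i - e * P $ Ztc i)"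
proof -
  define b where "b = Q - e *\<^sub>R P"
  define a :: "real ^ 'n coord" where "a = (\<chi> k. case k of
      Xs \<Rightarrow> b $ Xs - e * pot0 b * P $ Xc - (P $ Xc - m) * pairing P b
    | Zs i \<Rightarrow> b $ Zs i + (P $ Xc - m) * (P $ Xc - m) * (b $ Ztc i / 2)
    | Zts i \<Rightarrow> b $ Zts i + (P $ Xc - m) * (P $ Xc - m) * (b $ Zc i / 2)
    | _ \<Rightarrow> b $ k)"
  have p: "pairing P a = pairing P b" "pot0 a = pot0 b"
    by (simp_all add: pairing_def potential_def a_def)
  have "motion e m a P $ k = Q $ k" for k
    by (cases k) (simp_all add: motion_nth p, simp_all add: a_def b_def)
  then have "motion e m a P = Q" by (simp add: vec_eq_iff)
  then show ?thesis
    by (intro exI[of _ a]) (simp add: a_def b_def)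
qed

section \<open>Homogeneity and geodesic symmetries\<close>

lemma pseudo_riemannian_S_metric: "pseudo_riemannian S_metric"
  unfolding S_metric_def by (intro pseudo_riemannian_M_metric smooth_const)

lemma homogeneous_S_metric: "homogeneous (S_metric :: 'n::finite coord metric)"
  unfolding homogeneous_def
proof (intro conjI allI pseudo_riemannian_S_metric)
  fix P Q :: "real ^ 'n coord"
  obtain a where "motion 1 0 a P = Q"
    using motion_transitive by metis
  then show "\<exists>\<phi>. isometry S_metric S_metric \<phi> \<and> \<phi> P = Q"
    using isometry_motion[of 1 0 a] by auto
qed

lemma symmetric_space_S_metric: "symmetric_space (S_metric :: 'n::finite coord metric)"
  unfolding symmetric_space_def
proof (intro conjI allI pseudo_riemannian_S_metric)
  fix P :: "real ^ 'n coord"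
  obtain a where a: "motion (- 1) (P $ Xc) a P = P" "a $ Xc = 2 * P $ Xc"
    "\<And>i. a $ Zc i = 2 * P $ Zc i" "\<And>i. a $ Ztc i = 2 * P $ Ztc i"
    using motion_transitive[of "- 1" "P $ Xc" P P] by auto
  \<comment> \<open>At \<open>P\<close> the terms with factor \<open>P $ Xc - m\<close> vanish; this
    identity cancels the two remaining multiples of \<open>v $ Xc\<close> in the \<open>Xs\<close>
    component.\<close>
  have p: "pairing P a = pot0 a"
    by (simp add: potential_def pairing_def a algebra_simps)
  have "motion_deriv (-1) (P $ Xc) a P v = - v" for v
    unfolding vec_eq_iff
  proof
    show "motion_deriv (-1) (P $ Xc) a P v $ k = (- v) $ k" for k
      by (cases k) (simp_all add: motion_deriv_nth p)
  qed
  then show "\<exists>\<phi>. isometry S_metric S_metric \<phi> \<and> \<phi> P = P \<and> (\<forall>v. dird \<phi> P v = - v)"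
    using a(1) isometry_motion[of "-1" "P $ Xc" a]
    by (intro exI[of _ "motion (-1) (P $ Xc) a"]) (simp add: dird_eq[OF has_derivative_motion])
qed


section \<open>Holonomy and indecomposability\<close>

lemma has_vector_derivative_vec:
  fixes V :: "real \<Rightarrow> real ^ 'k::finite"
  assumes "\<And>k. ((\<lambda>t. V t $ k) has_real_derivative V' $ k) (at t within S)"
  shows "(V has_vector_derivative V') (at t within S)"
  unfolding has_vector_derivative_def
  by (rule has_derivative_vec) (use assms in \<open>simp add: has_field_derivative_def mult_commute_abs\<close>)

text \<open>The difference from the identity has square zero. The swap of \<open>Zc\<close> and
  \<open>Ztc\<close> in the last entries comes from raising the index of the form
  \<open>pairing c\<close>.\<close>

definition transvection :: "real ^ 'n::finite coord \<Rightarrow> real ^ 'n coord \<Rightarrow> real ^ 'n coord"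
  where "transvection c v = (\<chi> k. case k of
      Xs \<Rightarrow> v $ Xs + pairing c v
    | Zs i \<Rightarrow> v $ Zs i - v $ Xc * c $ Ztc i
    | Zts i \<Rightarrow> v $ Zts i - v $ Xc * c $ Zc i
    | _ \<Rightarrow> v $ k)"

text \<open>The Christoffel term uses only the x, z and z~ components of the transported vector.
  These stay constant, so parallel transport along a polynomial loop is integration of
  polynomials.\<close>

lemma transvection_in_holonomy:
  fixes P c :: "real ^ 'n::finite coord"
  shows "transvection c \<in> holonomy S_metric P"
proof -
  \<comment> \<open>\<open>\<integral> (t\<^sup>2 - t\<^sup>3) (1 - 2 t) dt = - 1/60\<close> over the unit interval, whence the factor 60.\<close>
  define \<gamma> where "\<gamma> t = (\<chi> k. case k of
      Xc \<Rightarrow> P $ Xc + (t - t ^ 2)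
    | Zc i \<Rightarrow> P $ Zc i - 60 * (t ^ 2 - t ^ 3) * c $ Zc i
    | Ztc i \<Rightarrow> P $ Ztc i - 60 * (t ^ 2 - t ^ 3) * c $ Ztc i
    | _ \<Rightarrow> P $ k)" for t
  define \<gamma>' :: "real \<Rightarrow> real ^ 'n coord" where "\<gamma>' t = (\<chi> k. case k of
      Xc \<Rightarrow> 1 - 2 * t
    | Zc i \<Rightarrow> - 60 * (2 * t - 3 * t ^ 2) * c $ Zc i
    | Ztc i \<Rightarrow> - 60 * (2 * t - 3 * t ^ 2) * c $ Ztc i
    | _ \<Rightarrow> 0)" for t
  \<comment> \<open>The factor of \<open>v $ Xc\<close> in \<open>Xs\<close> is the change of
    \<open>pot0\<close> along the loop, which returns to 0. The quintic is the antiderivative of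
    \<open>- 60 * (t ^ 2 - t ^ 3) * (1 - 2 * t)\<close>; it is 0 at the start and 1 at the
    end.\<close>
  define V where "V v t = (\<chi> k. case k of
      Xs \<Rightarrow> v $ Xs + v $ Xc * (3600 * (t ^ 2 - t ^ 3) ^ 2 * pot0 c - 60 * (t ^ 2 - t ^ 3) * pairing P c)
        + (t - t ^ 2) * pairing P v + (45 * t ^ 4 - 20 * t ^ 3 - 24 * t ^ 5) * pairing c v
    | Zs i \<Rightarrow> v $ Zs i - v $ Xc * ((t - t ^ 2) * P $ Ztc i + (45 * t ^ 4 - 20 * t ^ 3 - 24 * t ^ 5) * c $ Ztc i)
    | Zts i \<Rightarrow> v $ Zts i - v $ Xc * ((t - t ^ 2) * P $ Zc i + (45 * t ^ 4 - 20 * t ^ 3 - 24 * t ^ 5) * c $ Zc i)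
    | _ \<Rightarrow> v $ k)" for v and t :: real
  have V_nth: "V v t $ Xc = v $ Xc" "V v t $ Zc i = v $ Zc i" "V v t $ Ztc i = v $ Ztc i"
      "V v t $ Xs = v $ Xs + v $ Xc * (3600 * (t ^ 2 - t ^ 3) ^ 2 * pot0 c - 60 * (t ^ 2 - t ^ 3) * pairing P c)
        + (t - t ^ 2) * pairing P v + (45 * t ^ 4 - 20 * t ^ 3 - 24 * t ^ 5) * pairing c v"
      "V v t $ Zs i = v $ Zs i
        - v $ Xc * ((t - t ^ 2) * P $ Ztc i + (45 * t ^ 4 - 20 * t ^ 3 - 24 * t ^ 5) * c $ Ztc i)"
      "V v t $ Zts i = v $ Zts i
        - v $ Xc * ((t - t ^ 2) * P $ Zc i + (45 * t ^ 4 - 20 * t ^ 3 - 24 * t ^ 5) * c $ Zc i)"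
    for v t i by (simp_all add: V_def)
  have \<gamma>_nth: "\<gamma> t $ Zc i = P $ Zc i - 60 * (t ^ 2 - t ^ 3) * c $ Zc i"
      "\<gamma> t $ Ztc i = P $ Ztc i - 60 * (t ^ 2 - t ^ 3) * c $ Ztc i" for t i
    by (simp_all add: \<gamma>_def)
  have \<gamma>: "(\<gamma> has_vector_derivative \<gamma>' t) (at t)" for t
  proof (rule has_vector_derivative_vec)
    show "((\<lambda>t. \<gamma> t $ k) has_real_derivative \<gamma>' t $ k) (at t)" for k
      by (cases k) (auto simp: \<gamma>_def \<gamma>'_def algebra_simps intro!: derivative_eq_intros)
  qed
  have "continuous_on {0..1} \<gamma>'"
    unfolding \<gamma>'_def
  proof (rule continuous_on_vec_lambda)
    show "continuous_on {0..1} (\<lambda>t. case k of Xc \<Rightarrow> 1 - 2 * t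
      | Zc i \<Rightarrow> - 60 * (2 * t - 3 * t ^ 2) * c $ Zc i
      | Ztc i \<Rightarrow> - 60 * (2 * t - 3 * t ^ 2) * c $ Ztc i | _ \<Rightarrow> 0)" for k
      by (cases k) (auto intro!: continuous_intros)
  qed
  with \<gamma> have C1: "\<gamma> C1_differentiable_on {0..1}"
    unfolding C1_differentiable_on_def by blast
  have ends: "\<gamma> 0 = P" "\<gamma> 1 = P" "V v 0 = v" "V v 1 = transvection c v" for v
    by (auto simp: \<gamma>_def V_def transvection_def vec_eq_iff split: coord.split)
  have pair: "pairing (\<gamma> t) v = pairing P v - 60 * (t ^ 2 - t ^ 3) * pairing c v" for t v
    unfolding pairing_def \<gamma>_def sum_distrib_left sum_subtractf[symmetric]
    by (intro sum.cong refl) (simp add: algebra_simps)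
  have pair': "pairing v (\<gamma>' t) = - 60 * (2 * t - 3 * t ^ 2) * pairing v c" for t v
    unfolding pairing_def \<gamma>'_def sum_distrib_left
    by (intro sum.cong refl) (simp add: algebra_simps)
  have pairV: "pairing w (V v t) = pairing w v" for w v t
    unfolding pairing_def V_def by simp
  have "parallel_along S_metric \<gamma> (V v)" for v
    unfolding parallel_along_def
  proof
    fix t :: real
    have "((\<lambda>t. V v t $ k) has_real_derivative (- christoffel S_metric (\<gamma> t) (\<gamma>' t) (V v t)) $ k)
        (at t within {0..1})" for k
    proof -
      have D: "dird pot0 (\<gamma> t) u = pairing (\<gamma> t) u" for u
        by (simp add: dird_potential smooth_const)
      have cc: "pairing c c = 2 * pot0 c"
        by (simp add: pot0_eq_pairing)
      have chr: "(- christoffel S_metric (\<gamma> t) (\<gamma>' t) (V v t)) $ k = (case k of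
          Xs \<Rightarrow> pairing (\<gamma> t) (\<gamma>' t) * v $ Xc + pairing (\<gamma> t) v * (1 - 2 * t)
        | Zs i \<Rightarrow> - (1 - 2 * t) * v $ Xc * \<gamma> t $ Ztc i
        | Zts i \<Rightarrow> - (1 - 2 * t) * v $ Xc * \<gamma> t $ Zc i
        | _ \<Rightarrow> 0)"
        unfolding S_metric_def christoffel_M_metric[OF smooth_const] D pairV
        by (cases k) (simp_all add: pairing_axis, simp_all add: V_def \<gamma>'_def algebra_simps)
      show ?thesis
        unfolding chr pair pair'
        by (cases k) (simp_all only: coord.case V_nth \<gamma>_nth, (auto simp: cc field_simps
            power2_eq_square power3_eq_cube power4_eq_xxxx intro!: derivative_eq_intros)+)
    qed
    then show "(V v has_vector_derivative
        - christoffel S_metric (\<gamma> t) (vector_derivative \<gamma> (at t)) (V v t)) (at t within {0..1})"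
      unfolding vector_derivative_at[OF \<gamma>] by (rule has_vector_derivative_vec)
  qed
  with C1 ends show ?thesis
    unfolding holonomy_def by blast
qed

section \<open>Invariant orthogonal decompositions\<close>

lemma decomposition_commute:
  assumes "decomposition (M_metric f P) U W"
  shows "decomposition (M_metric f P) W U"
  unfolding decomposition_def
proof (intro conjI allI ballI)
  show "subspace W" "subspace U" "W \<inter> U = {0}"
    using assms by (auto simp: decomposition_def)
  show "\<exists>w\<in>W. \<exists>u\<in>U. v = w + u" for v
  proof -
    obtain u w where "u \<in> U" "w \<in> W" "v = u + w"
      using assms unfolding decomposition_def by blast
    then show ?thesis by (intro bexI[of _ w] bexI[of _ u]) simp_all
  qed
  show "bform (M_metric f P) w u = 0" if "w \<in> W" "u \<in> U" for w u
    using assms that unfolding decomposition_def bform_M_metric_commute[of f P w u] by blast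
qed

lemma trivial_summand_S_metric:
  fixes P :: "real ^ 'n::finite coord"
  assumes dec: "decomposition (S_metric P) U W"
    and inv: "\<And>c. transvection c ` U \<subseteq> U" "\<And>c. transvection c ` W \<subseteq> W"
    and u: "u \<in> U" "u $ Xc \<noteq> 0"
  shows "W = {0}"
proof -
  have U: "subspace U" and W: "subspace W" and UW: "U \<inter> W = {0}"
    and span: "\<And>v. \<exists>u\<in>U. \<exists>w\<in>W. v = u + w"
    and orth: "\<And>u w. u \<in> U \<Longrightarrow> w \<in> W \<Longrightarrow> bform (S_metric P) u w = 0"
    using dec unfolding decomposition_def by auto
  define N where "N c v = transvection c v - v" for c v :: "real ^ 'n coord"
  have N_nth: "N c v $ Xc = 0" "N c v $ Zc i = 0" "N c v $ Ztc i = 0" "N c v $ Xs = pairing c v"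
    "N c v $ Zs i = - v $ Xc * c $ Ztc i" "N c v $ Zts i = - v $ Xc * c $ Zc i" for c v i
    by (simp_all add: N_def transvection_def)
  have NU: "N c v \<in> U" if "v \<in> U" for c v
    using inv(1)[of c] that U unfolding N_def by (auto intro: subspace_diff)
  have NW: "N c v \<in> W" if "v \<in> W" for c v
    using inv(2)[of c] that W unfolding N_def by (auto intro: subspace_diff)
  \<comment> \<open>Invariance puts \<open>N c u\<close> into \<open>U\<close>, hence orthogonal to
    \<open>w\<close>; letting \<open>c\<close> run through the axes compares the components one by
    one.\<close>
  have proportional: "u $ Xc * w $ Zc i = w $ Xc * u $ Zc i" "u $ Xc * w $ Ztc i = w $ Xc * u $ Ztc i"
    if "w \<in> W" for w i
  proof -
    have "pairing c u * w $ Xc - u $ Xc * pairing c w = 0" for c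
      using orth[OF NU[OF u(1)] that, of c] unfolding S_metric_def bform_M_metric pairing_def[of c w]
      by (simp add: N_nth sum.distrib sum_distrib_left algebra_simps sum_negf sum_subtractf)
    from this[of "axis (Ztc i) 1"] this[of "axis (Zc i) 1"]
    show "u $ Xc * w $ Zc i = w $ Xc * u $ Zc i" "u $ Xc * w $ Ztc i = w $ Xc * u $ Ztc i"
      by (simp_all add: pairing_commute[of "axis _ _"] pairing_axis mult.commute)
  qed
  have x0: "w $ Xc = 0" if "w \<in> W" for w
  proof -
    fix i :: 'n
    let ?c = "axis (Zc i) 1"
    \<comment> \<open>By proportionality the same vector lies in \<open>U\<close> and in
      \<open>W\<close>, so it is zero; its \<open>Zts i\<close> entry is
      \<open>- w $ Xc * u $ Xc\<close>.\<close>
    have eq: "u $ Xc *\<^sub>R N ?c w = w $ Xc *\<^sub>R N ?c u"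
      unfolding vec_eq_iff
    proof
      show "(u $ Xc *\<^sub>R N ?c w) $ k = (w $ Xc *\<^sub>R N ?c u) $ k" for k
        by (cases k) (simp_all add: N_nth pairing_commute[of "axis _ _"] pairing_axis proportional[OF that])
    qed
    have "w $ Xc *\<^sub>R N ?c u \<in> U"
      by (intro subspace_scale U NU u(1))
    moreover have "w $ Xc *\<^sub>R N ?c u \<in> W"
      unfolding eq[symmetric] by (intro subspace_scale W NW that)
    ultimately have "w $ Xc *\<^sub>R N ?c u = 0"
      using UW by blast
    then have "(w $ Xc *\<^sub>R N ?c u) $ Zts i = 0" by (simp only: zero_index)
    with u(2) show "w $ Xc = 0" by (simp add: N_nth axis_def)
  qed
  have y0: "w $ Zc i = 0" "w $ Ztc i = 0" if "w \<in> W" for w i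
    using proportional[OF that] x0[OF that] u(2) by auto
  have "w = 0" if "w \<in> W" for w
  proof (rule bform_M_metric_nondegenerate)
    fix v
    obtain u' w' where v: "v = u' + w'" "u' \<in> U" "w' \<in> W"
      using span by blast
    \<comment> \<open>Both vectors have only dual components left, and the dual directions are
      totally isotropic.\<close>
    have "bform (S_metric P) w' w = 0"
      unfolding S_metric_def bform_M_metric using x0 y0 that v(3) by simp
    with v orth[OF v(2) that] show "bform (M_metric (\<lambda>_. 0) P) v w = 0"
      by (simp add: bform_def inner_add_left S_metric_def)
  qed
  then show ?thesis using subspace_0[OF W] by blast
qed

lemma indecomposable_S_metric: "indecomposable (S_metric :: 'n::finite coord metric)"
  unfolding indecomposable_def
proof (intro allI notI, elim exE conjE)
  fix P :: "real ^ 'n coord" and U W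
  assume dec: "decomposition (S_metric P) U W" and "U \<noteq> {0}" "W \<noteq> {0}"
    and hol: "\<forall>T\<in>holonomy S_metric P. T ` U \<subseteq> U \<and> T ` W \<subseteq> W"
  have inv: "transvection c ` U \<subseteq> U" "transvection c ` W \<subseteq> W" for c
    using hol transvection_in_holonomy by blast+
  \<comment> \<open>Splitting the field \<open>\<partial>\<^sub>x\<close> shows that one of the
    summands contains a vector with nonzero x-component; the two cases are exchanged by
    symmetry.\<close>
  obtain u w where uw: "u \<in> U" "w \<in> W" "axis Xc 1 = u + w"
    using dec unfolding decomposition_def by blast
  then have "u $ Xc + w $ Xc = 1"
    by (metis axis_nth vector_add_component)
  then consider "u $ Xc \<noteq> 0" | "w $ Xc \<noteq> 0" by fastforce
  then show False
  proof cases
    case 1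
    from trivial_summand_S_metric[OF dec inv uw(1) 1] \<open>W \<noteq> {0}\<close> show False by simp
  next
    case 2
    from dec have "decomposition (S_metric P) W U"
      unfolding S_metric_def by (rule decomposition_commute)
    from trivial_summand_S_metric[OF this inv(2,1) uw(2) 2] \<open>U \<noteq> {0}\<close> show False by simp
  qed
qed

theorem theorem1p7:
  fixes p :: nat
  assumes "p \<ge> 1" and "CARD('n::finite) = p + 1"
  shows "(symmetric_space (S_metric :: 'n coord metric) \<and>
          indecomposable (S_metric :: 'n coord metric)) \<and>
         (\<forall>f :: real ^ 'n \<Rightarrow> real. smooth f \<longrightarrow>
            modeled_on 0 (M_metric f) (S_metric :: 'n coord metric))"
  by (auto simp: symmetric_space_S_metric indecomposable_S_metric modeled_on_def
      pseudo_riemannian_M_metric homogeneous_S_metric intro: model_iso_0_M_metric)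

end
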